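(* Assume $\lambda_C<\mu_{\mathcal{S}(C)}$ for every nonempty $C\subseteq\mathcal{C}$. Let $\dots,z^{-1},z^0,z^1,\dots$ be the i.i.d. sequence of the FCFS infinite directed matching model, and let $\dots,\tilde z^{-1},\tilde z^0,\tilde z^1,\dots$ be the sequence obtained from it by the exchange transformation. Then $\dots,\tilde z^{-1},\tilde z^0,\tilde z^1,\dots$ is an i.i.d. sequence. Moreover, almost surely, the unique directed FCFS matching of the new sequence performed in reversed time results in exactly the reversed matches of the original sequence (i.e. positions $m<n$ are matched in the original sequence if and only if they are matched in the exchanged sequence in reversed time).
   Context: Customer types are $\mathcal{C}=\{c_1,\dots,c_I\}$, server types are $\mathcal{S}=\{s_1,\dots,s_J\}$, and $\mathfrak{E}\subseteq\mathcal{S}\times\mathcal{C}$ is a compatibility relation. $\mathcal{S}(c_i)$ is the set of server types compatible with $c_i$; $\mathcal{S}(C)=\bigcup_{c\in C}\mathcal{S}(c)$. Rates $\lambda_{c_i}>0$, $\mu_{s_j}>0$ are given; $\lambda_C=\sum_{c\in C}\lambda_c$, $\mu_S=\sum_{s\in S}\mu_s$, $\bar\lambda=\sum_i\lambda_{c_i}$, $\bar\mu=\sum_j\mu_{s_j}$. FCFS infinite directed matching model: $\dots,z^{-1},z^0,z^1,\dots$ is i.i.d., each $z^n$ being customer type $c_i$ with probability $\lambda_{c_i}/(\bar\lambda+\bar\mu)$ and server type $s_j$ with probability $\mu_{s_j}/(\bar\lambda+\bar\mu)$. A directed FCFS matching is a partial matching pairing servers with compatible customers at earlier positions, each element in at most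 one pair, such that every server $z^n$ is matched to the earliest customer $z^m$, $m<n$, that is compatible with $z^n$ and is not matched to a server at a position before $n$, and is unmatched if and only if there is no such customer. Under the stated stability condition, almost surely there is a unique directed FCFS matching in which every customer is matched; this is the matching used. Exchange transformation: if customer $z^m=c_i$ is matched to server $z^n=s_j$, $m<n$, then $\tilde z^m=s_j$ and $\tilde z^n=c_i$; if $z^n=s_j$ is unmatched, then $\tilde z^n=z^n$. The directed FCFS matching of $(\tilde z^n)$ in reversed time is the directed FCFS matching (covering all customers) of the sequence $w^n=\tilde z^{-n}$, with positions translated back.
   Formalization: A directed FCFS matching covering all customers is not unique in general (an infinite backlog from the remote past gives others), so "the unique matching" is taken to be the limit of the FCFS matchings started empty at −k as k→∞, for both the original and the reversed sequence. *)

theory Defs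
  imports "HOL-Probability.Probability"
begin

text \<open>
  Customer types are the elements of \<open>'c\<close>, server types those of \<open>'s\<close>. An item sequence is a
  function \<open>x :: int \<Rightarrow> 'c + 's\<close>, where \<open>Inl c\<close> is a customer and \<open>Inr s\<close> a server. A matching is a
  set of pairs \<open>(m, n)\<close> of positions, the position of the customer being the first component.
\<close>

definition servers_of :: "('s \<times> 'c) set \<Rightarrow> 'c set \<Rightarrow> 's set" where
  "servers_of E C = {s. \<exists>c\<in>C. (s, c) \<in> E}"

definition compatible_at :: "('s \<times> 'c) set \<Rightarrow> (int \<Rightarrow> 'c + 's) \<Rightarrow> int \<Rightarrow> int \<Rightarrow> bool" where
  "compatible_at E x m n \<longleftrightarrow> (\<exists>c s. x m = Inl c \<and> x n = Inr s \<and> (s, c) \<in> E)"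

text \<open>The index set \<open>I\<close> (all integers, or a half-line) is the set of positions that take part.\<close>

definition available ::
  "('s \<times> 'c) set \<Rightarrow> int set \<Rightarrow> (int \<Rightarrow> 'c + 's) \<Rightarrow> (int \<times> int) set \<Rightarrow> int \<Rightarrow> int set" where
  "available E I x A n =
     {m \<in> I. m < n \<and> compatible_at E x m n \<and> (\<forall>k. (m, k) \<in> A \<longrightarrow> \<not> k < n)}"

definition directed_fcfs ::
  "('s \<times> 'c) set \<Rightarrow> int set \<Rightarrow> (int \<Rightarrow> 'c + 's) \<Rightarrow> (int \<times> int) set \<Rightarrow> bool" where
  "directed_fcfs E I x A \<longleftrightarrow>
     (\<forall>m n. (m, n) \<in> A \<longrightarrow> m \<in> I \<and> n \<in> I \<and> m < n \<and> compatible_at E x m n) \<and>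
     (\<forall>m n n'. (m, n) \<in> A \<and> (m, n') \<in> A \<longrightarrow> n = n') \<and>
     (\<forall>m m' n. (m, n) \<in> A \<and> (m', n) \<in> A \<longrightarrow> m = m') \<and>
     (\<forall>n\<in>I. \<forall>s. x n = Inr s \<longrightarrow>
        (\<forall>m. (m, n) \<in> A \<longrightarrow> m \<in> available E I x A n \<and> (\<forall>m'\<in>available E I x A n. m \<le> m')) \<and>
        ((\<nexists>m. (m, n) \<in> A) \<longleftrightarrow> available E I x A n = {}))"

definition covers_customers :: "(int \<Rightarrow> 'c + 's) \<Rightarrow> (int \<times> int) set \<Rightarrow> bool" where
  "covers_customers x A \<longleftrightarrow> (\<forall>m c. x m = Inl c \<longrightarrow> (\<exists>n. (m, n) \<in> A))"

text \<open>
  Loynes' construction: \<open>A\<close> is the pointwise limit, as \<open>k\<close> tends to infinity, of the directed FCFS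
  matchings of the half-line sequences \<open>x\<^sup>-\<^sup>k, x\<^sup>-\<^sup>k\<^sup>+\<^sup>1, \<dots>\<close> (each of which is unique, by induction
  along the half-line).
\<close>

definition loynes_limit ::
  "('s \<times> 'c) set \<Rightarrow> (int \<Rightarrow> 'c + 's) \<Rightarrow> (int \<times> int) set \<Rightarrow> bool" where
  "loynes_limit E x A \<longleftrightarrow>
     (\<exists>B :: nat \<Rightarrow> (int \<times> int) set.
        (\<forall>k. directed_fcfs E {- int k..} x (B k)) \<and>
        (\<forall>m n. \<forall>\<^sub>F k in sequentially. (m, n) \<in> B k \<longleftrightarrow> (m, n) \<in> A))"

text \<open>
  A directed FCFS matching of the two-sided sequence covering all customers is pathwise unique only
  among those that are not fed by an infinite backlog in the remote past. With one customer type,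
  one compatible server type and \<open>\<lambda> < \<mu>\<close>, number the customers and the servers by integers in
  the order of their positions, starting from 0 at the first nonnegative position. Almost surely,
  for every large enough \<open>k\<close>, matching customer \<open>i\<close> to server
  \<open>i + k\<close> for all \<open>i < - k\<close> and continuing FCFS from there gives another directed FCFS matching that
  covers all customers. The requirement \<open>loynes_limit\<close> singles out the stationary matching.
\<close>

definition two_sided_fcfs ::
  "('s \<times> 'c) set \<Rightarrow> (int \<Rightarrow> 'c + 's) \<Rightarrow> (int \<times> int) set \<Rightarrow> bool" where
  "two_sided_fcfs E x A \<longleftrightarrow>
     directed_fcfs E UNIV x A \<and> covers_customers x A \<and> loynes_limit E x A"

definition the_matching :: "('s \<times> 'c) set \<Rightarrow> (int \<Rightarrow> 'c + 's) \<Rightarrow> (int \<times> int) set" where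
  "the_matching E x = (THE A. two_sided_fcfs E x A)"

definition exchange :: "(int \<times> int) set \<Rightarrow> (int \<Rightarrow> 'c + 's) \<Rightarrow> int \<Rightarrow> 'c + 's" where
  "exchange A x n =
     (if \<exists>m. (m, n) \<in> A \<or> (n, m) \<in> A then x (THE m. (m, n) \<in> A \<or> (n, m) \<in> A) else x n)"

definition iid_sequence :: "'w measure \<Rightarrow> (int \<Rightarrow> 'w \<Rightarrow> 'a) \<Rightarrow> bool" where
  "iid_sequence M X \<longleftrightarrow>
     prob_space.indep_vars M (\<lambda>_. count_space UNIV) X UNIV \<and>
     (\<forall>i j. distr M (count_space UNIV) (X i) = distr M (count_space UNIV) (X j))"

end

theory Submission
  imports Defs "HOL-Library.Sublist"
begin

text \<open>
  Call a position a regeneration point if no customer before it is still waiting there. The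
  stationary distribution of the list of waiting customers has product form, and by stability it
  is normalisable. A system started empty is dominated by a stationary one, so the probability of
  being empty stays bounded away from zero, and regeneration points are almost surely unbounded in
  both directions. They cut the sequence into blocks matched within themselves, which yields the
  Loynes limit.

  Exchanging matched items and reversing time turns the matching into the first-come-first-served
  matching of the new sequence: a violation of the discipline in one direction of time is a
  violation in the other. Hence exchange and reversal form an involution that maps regeneration
  points to regeneration points and permutes the items of every block. The probability that a
  given block starts at a given regeneration point depends only on the items of the block, so the
  involution preserves the law of the i.i.d. sequence.
\<close>

subsection \<open>First-come-first-served matchings\<close>

text \<open>Whole-line uniqueness depends on the remote past, so regeneration is expressed without
  any matching: \<open>empties_at\<close> asks that every system started empty earlier be empty
  again. It concerns only items before the point and is therefore independent of the items from that
  point on. Hence the probability that a given word starts at a regeneration point is the constant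
  \<open>empty_prob\<close> times the product of its item probabilities. This formula carries both
  the recurrence argument and the invariance of the law.

  A positive probability of emptiness is turned into almost sure recurrence through the finiteness
  of busy periods: for suitably spaced starting times, the events that the system is empty, a fixed
  list arrives and a long busy spell follows are disjoint and equally likely, so long spells are
  rare. Averaging over the stationary state gives a bound uniform in the starting time, which serves
  past and future alike.

  Monotonicity of the queue in the sublist order does the work of a coupling throughout.\<close>

definition earliest :: "int set \<Rightarrow> int \<Rightarrow> bool" where
  "earliest S m \<longleftrightarrow> m \<in> S \<and> (\<forall>m'\<in>S. m \<le> m')"

lemma earliest_unique: "earliest S m \<Longrightarrow> earliest S m' \<Longrightarrow> m = m'"
  unfolding earliest_def by (meson order_antisym)

text \<open>Turns the discipline into a recursion: whether \<open>(m, n)\<close> belongs to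
  \<open>A\<close> is decided by the pairs with server position below \<open>n\<close>. The second
  conjunct is separate because on the whole line a nonempty set of available customers may lack a
  least element, and the first conjunct alone would then leave the server unmatched.\<close>

lemma directed_fcfs_iff:
  "directed_fcfs E I x A \<longleftrightarrow>
     (\<forall>m n. (m, n) \<in> A \<longleftrightarrow> n \<in> I \<and> earliest (available E I x A n) m) \<and>
     (\<forall>n\<in>I. available E I x A n \<noteq> {} \<longrightarrow> (\<exists>m. (m, n) \<in> A))" (is "?L \<longleftrightarrow> ?R1 \<and> ?R2")
proof
  assume L: ?L
  have 1: "n \<in> I \<and> earliest (available E I x A n) m" if "(m, n) \<in> A" for m n
    using L that unfolding directed_fcfs_def compatible_at_def earliest_def by metis
  have 2: ?R2
    using L unfolding directed_fcfs_def available_def compatible_at_def by (smt (verit) Collect_empty_eq)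
  have 3: "(m, n) \<in> A" if "n \<in> I" "earliest (available E I x A n) m" for m n
  proof -
    from that have "available E I x A n \<noteq> {}" by (auto simp: earliest_def)
    with 2 that obtain m' where "(m', n) \<in> A" by blast
    with 1 that show ?thesis using earliest_unique by blast
  qed
  show "?R1 \<and> ?R2" using 1 2 3 by blast
next
  assume R: "?R1 \<and> ?R2"
  have E: "n \<in> I \<and> earliest (available E I x A n) m" if "(m, n) \<in> A" for m n
    using R that by blast
  have 1: "m \<in> I \<and> n \<in> I \<and> m < n \<and> compatible_at E x m n" if "(m, n) \<in> A" for m n
    using E[OF that] by (simp add: earliest_def available_def)
  have 2: "n = n'" if "(m, n) \<in> A" "(m, n') \<in> A" for m n n'
  proof -
    have "\<not> n < n'" using E[OF that(2)] that(1) by (auto simp: earliest_def available_def)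
    moreover have "\<not> n' < n" using E[OF that(1)] that(2) by (auto simp: earliest_def available_def)
    ultimately show ?thesis by simp
  qed
  have 3: "m = m'" if "(m, n) \<in> A" "(m', n) \<in> A" for m n m'
    using E that earliest_unique by blast
  have 4: "(\<nexists>m. (m, n) \<in> A) \<longleftrightarrow> available E I x A n = {}" if "n \<in> I" for n
    using R that E[of _ n] unfolding earliest_def by blast
  have 5: "m \<in> available E I x A n \<and> (\<forall>m'\<in>available E I x A n. m \<le> m')" if "(m, n) \<in> A" for m n
    using E[OF that] unfolding earliest_def by blast
  show ?L unfolding directed_fcfs_def
    by (intro conjI allI impI ballI; (elim conjE)?) (use 1 2 3 4 5 in \<open>(assumption | simp | metis)+\<close>)
qed

lemma directed_fcfs_earliest:
  "directed_fcfs E I x A \<Longrightarrow> (m, n) \<in> A \<Longrightarrow> earliest (available E I x A n) m"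
  unfolding directed_fcfs_iff by blast

lemma directed_fcfs_matched:
  "directed_fcfs E I x A \<Longrightarrow> n \<in> I \<Longrightarrow> available E I x A n \<noteq> {} \<Longrightarrow> \<exists>m. (m, n) \<in> A"
  unfolding directed_fcfs_iff by blast

lemma directed_fcfsD:
  assumes "directed_fcfs E I x A" "(m, n) \<in> A"
  shows "m \<in> I" "n \<in> I" "m < n" "compatible_at E x m n"
  using assms unfolding directed_fcfs_def by blast+

lemma directed_fcfs_right_unique:
  "directed_fcfs E I x A \<Longrightarrow> (m, n) \<in> A \<Longrightarrow> (m, n') \<in> A \<Longrightarrow> n = n'"
  unfolding directed_fcfs_def by blast

lemma directed_fcfs_left_unique:
  "directed_fcfs E I x A \<Longrightarrow> (m, n) \<in> A \<Longrightarrow> (m', n) \<in> A \<Longrightarrow> m = m'"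
  unfolding directed_fcfs_def by blast

lemma available_cong:
  assumes "\<And>m k. k < n \<Longrightarrow> (m, k) \<in> A \<longleftrightarrow> (m, k) \<in> B"
  shows "available E I x A n = available E I x B n"
  using assms unfolding available_def by blast

lemma directed_fcfs_cong:
  assumes "\<And>n. n \<in> I \<Longrightarrow> x n = y n"
  shows "directed_fcfs E I x A \<longleftrightarrow> directed_fcfs E I y A"
proof -
  have "available E I x A n = available E I y A n" if "n \<in> I" for n
    using assms that unfolding available_def compatible_at_def by auto
  then show ?thesis by (simp add: directed_fcfs_iff cong: conj_cong ball_cong)
qed

text \<open>Strong induction on the position of the server; the lower bound on \<open>I\<close>
  makes it well founded.\<close>

lemma directed_fcfs_unique:
  assumes A: "directed_fcfs E I x A" and B: "directed_fcfs E I x B" and I: "I \<subseteq> {i..}"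
  shows "A = B"
proof -
  have "\<forall>m. (m, n) \<in> A \<longleftrightarrow> (m, n) \<in> B" for n
  proof (induction "nat (n - i)" arbitrary: n rule: less_induct)
    case less
    show ?case
    proof (cases "i \<le> n")
      case True
      have "available E I x A n = available E I x B n"
      proof (rule available_cong)
        fix m k :: int assume k: "k < n"
        show "(m, k) \<in> A \<longleftrightarrow> (m, k) \<in> B"
        proof (cases "i \<le> k")
          case True
          with k show ?thesis by (intro less[rule_format]) auto
        next
          case False
          then show ?thesis using directed_fcfsD(2)[OF A] directed_fcfsD(2)[OF B] I by force
        qed
      qed
      then show ?thesis using A B unfolding directed_fcfs_iff by metis
    next
      case False
      then show ?thesis using directed_fcfsD(2)[OF A] directed_fcfsD(2)[OF B] I by force
    qed
  qed
  then show ?thesis by auto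
qed

section \<open>Existence of the matching on a half-line\<close>

fun half_upto :: "('s \<times> 'c) set \<Rightarrow> int \<Rightarrow> (int \<Rightarrow> 'c + 's) \<Rightarrow> nat \<Rightarrow> (int \<times> int) set" where
  "half_upto E i x 0 = {}"
| "half_upto E i x (Suc n) = half_upto E i x n \<union>
     {(m, k). k = i + int n \<and> earliest (available E {i..} x (half_upto E i x n) k) m}"

definition half_matching :: "('s \<times> 'c) set \<Rightarrow> int \<Rightarrow> (int \<Rightarrow> 'c + 's) \<Rightarrow> (int \<times> int) set" where
  "half_matching E i x = (\<Union>n. half_upto E i x n)"

lemma half_upto_bound: "(m, k) \<in> half_upto E i x n \<Longrightarrow> i \<le> k \<and> k < i + int n"
  by (induction n) auto

lemma half_upto_mono: "n \<le> n' \<Longrightarrow> half_upto E i x n \<subseteq> half_upto E i x n'"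
  by (rule lift_Suc_mono_le) auto

text \<open>Stage \<open>n\<close> decides exactly the servers before \<open>i + n\<close>: each
  later stage adds pairs only at its own, later server position.\<close>

lemma half_upto_iff: "(m, k) \<in> half_upto E i x n \<longleftrightarrow> (m, k) \<in> half_matching E i x \<and> k < i + int n"
proof
  assume "(m, k) \<in> half_upto E i x n"
  then show "(m, k) \<in> half_matching E i x \<and> k < i + int n"
    using half_upto_bound unfolding half_matching_def by blast
next
  assume *: "(m, k) \<in> half_matching E i x \<and> k < i + int n"
  then obtain n' where n': "(m, k) \<in> half_upto E i x n'" unfolding half_matching_def by blast
  show "(m, k) \<in> half_upto E i x n"
  proof (cases "n' \<le> n")
    case True with n' half_upto_mono show ?thesis by blast
  next
    case False
    have "(m, k) \<in> half_upto E i x (n + d) \<Longrightarrow> (m, k) \<in> half_upto E i x n" for d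
      using * by (induction d) auto
    from this[of "n' - n"] False n' show ?thesis by simp
  qed
qed

lemma directed_fcfs_half: "directed_fcfs E {i..} x (half_matching E i x)"
proof -
  let ?A = "half_matching E i x"
  have av: "available E {i..} x (half_upto E i x (nat (n - i))) n = available E {i..} x ?A n"
    if "i \<le> n" for n
    using that by (intro available_cong) (auto simp: half_upto_iff)
  have iff: "(m, n) \<in> ?A \<longleftrightarrow> n \<in> {i..} \<and> earliest (available E {i..} x ?A n) m" for m n
  proof (cases "i \<le> n")
    case True
    then have "(m, n) \<in> ?A \<longleftrightarrow> (m, n) \<in> half_upto E i x (Suc (nat (n - i)))"
      by (auto simp: half_upto_iff simp del: half_upto.simps)
    also have "\<dots> \<longleftrightarrow> earliest (available E {i..} x (half_upto E i x (nat (n - i))) n) m"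
      using True half_upto_bound[of m n E i x "nat (n - i)"] by auto
    also note av[OF True]
    finally show ?thesis using True by simp
  next
    case False
    then show ?thesis using half_upto_bound unfolding half_matching_def by fastforce
  qed
  moreover have "\<exists>m. (m, n) \<in> ?A" if "n \<in> {i..}" "available E {i..} x ?A n \<noteq> {}" for n
  proof -
    \<comment> \<open>On a half-line only finitely many positions precede \<open>n\<close>, so a
      nonempty set of candidates has a minimum.\<close>
    have "finite (available E {i..} x ?A n)"
      by (rule finite_subset[of _ "{i..<n}"]) (auto simp: available_def)
    with that have "earliest (available E {i..} x ?A n) (Min (available E {i..} x ?A n))"
      by (simp add: earliest_def)
    with iff that show ?thesis by blast
  qed
  ultimately show ?thesis unfolding directed_fcfs_iff by blast
qed

lemma half_matching_eqI: "directed_fcfs E {i..} x A \<Longrightarrow> half_matching E i x = A"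
  using directed_fcfs_unique[OF directed_fcfs_half] by blast

lemma directed_fcfs_restrict_less:
  assumes A: "directed_fcfs E I x A"
  shows "directed_fcfs E (I \<inter> {..<j}) x {(m, n) \<in> A. n < j}"
proof -
  have av: "available E (I \<inter> {..<j}) x {(m, n) \<in> A. n < j} n = available E I x A n" if "n < j" for n
    using that unfolding available_def by auto
  show ?thesis
    using A av unfolding directed_fcfs_iff by auto
qed

text \<open>Regeneration relative to a given matching; \<open>empties_at\<close> is the version that
  depends on the sequence alone, and \<open>regenerative_empties_at_iff\<close> identifies the
  two.\<close>

definition cut_at :: "int set \<Rightarrow> (int \<Rightarrow> 'c + 's) \<Rightarrow> (int \<times> int) set \<Rightarrow> int \<Rightarrow> bool" where
  "cut_at I x A i \<longleftrightarrow> (\<forall>m\<in>I. \<forall>c. m < i \<longrightarrow> x m = Inl c \<longrightarrow> (\<exists>n<i. (m, n) \<in> A))"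

lemma cut_at_pair:
  assumes A: "directed_fcfs E I x A" and cut: "cut_at I x A i" and mn: "(m, n) \<in> A"
  shows "i \<le> m \<longleftrightarrow> i \<le> n"
proof
  assume "i \<le> m" then show "i \<le> n" using directed_fcfsD(3)[OF A mn] by simp
next
  assume n: "i \<le> n"
  show "i \<le> m"
  proof (rule ccontr)
    assume "\<not> i \<le> m"
    moreover obtain c where "x m = Inl c"
      using directed_fcfsD(4)[OF A mn] unfolding compatible_at_def by blast
    ultimately obtain n' where "n' < i" "(m, n') \<in> A"
      using cut directed_fcfsD(1)[OF A mn] unfolding cut_at_def by (meson not_le)
    with directed_fcfs_right_unique[OF A mn] n show False by auto
  qed
qed

text \<open>Customers before the cut are already taken when the servers after it choose, so dropping
  them changes no set of candidates.\<close>

lemma directed_fcfs_restrict_cut: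
  assumes A: "directed_fcfs E I x A" and cut: "cut_at I x A i"
  shows "directed_fcfs E (I \<inter> {i..}) x {(m, n) \<in> A. i \<le> m}"
proof -
  let ?B = "{(m, n) \<in> A. i \<le> m}"
  have av: "available E (I \<inter> {i..}) x ?B n = available E I x A n" if "i \<le> n" for n
  proof -
    have "i \<le> m" if "m \<in> available E I x A n" for m
    proof (rule ccontr)
      assume "\<not> i \<le> m"
      with that cut obtain k where "k < i" "(m, k) \<in> A"
        unfolding cut_at_def available_def compatible_at_def by (auto simp: not_le)
      with that \<open>i \<le> n\<close> show False unfolding available_def by auto
    qed
    then show ?thesis unfolding available_def by auto
  qed
  have "(m, n) \<in> ?B \<longleftrightarrow> n \<in> I \<inter> {i..} \<and> earliest (available E (I \<inter> {i..}) x ?B n) m" for m n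
    using A av[of n] cut_at_pair[OF A cut, of m n] unfolding directed_fcfs_iff by auto
  moreover have "\<exists>m. (m, n) \<in> ?B" if n: "n \<in> I \<inter> {i..}" "available E (I \<inter> {i..}) x ?B n \<noteq> {}" for n
  proof -
    from n av[of n] have "available E I x A n \<noteq> {}" by simp
    then obtain m where "(m, n) \<in> A" using directed_fcfs_matched[OF A] n by blast
    then show ?thesis using cut_at_pair[OF A cut] n by auto
  qed
  ultimately show ?thesis unfolding directed_fcfs_iff by blast
qed

section \<open>The list of waiting customers as a queue\<close>

fun take_first :: "('s \<times> 'c) set \<Rightarrow> 's \<Rightarrow> 'c list \<Rightarrow> 'c list" where
  "take_first E s [] = []"
| "take_first E s (c # q) = (if (s, c) \<in> E then q else c # take_first E s q)"

fun step :: "('s \<times> 'c) set \<Rightarrow> 'c list \<Rightarrow> 'c + 's \<Rightarrow> 'c list" where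
  "step E q (Inl c) = q @ [c]"
| "step E q (Inr s) = take_first E s q"

definition run :: "('s \<times> 'c) set \<Rightarrow> 'c list \<Rightarrow> ('c + 's) list \<Rightarrow> 'c list" where
  "run E q v = foldl (step E) q v"

lemma run_Nil [simp]: "run E q [] = q"
  and run_Cons [simp]: "run E q (a # v) = run E (step E q a) v"
  and run_append [simp]: "run E q (v @ v') = run E (run E q v) v'"
  by (simp_all add: run_def)

definition word :: "(int \<Rightarrow> 'a) \<Rightarrow> int \<Rightarrow> nat \<Rightarrow> 'a list" where
  "word x i n = map (\<lambda>k. x (i + int k)) [0..<n]"

lemma length_word [simp]: "length (word x i n) = n"
  by (simp add: word_def)

lemma word_0 [simp]: "word x i 0 = []"
  by (simp add: word_def)

lemma word_Suc: "word x i (Suc n) = word x i n @ [x (i + int n)]"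
  by (simp add: word_def)

lemma word_add: "word x i (n + m) = word x i n @ word x (i + int n) m"
  by (rule nth_equalityI) (auto simp: word_def nth_append)

lemma word_Suc': "word x i (Suc n) = x i # word x (i + 1) n"
  using word_add[of x i 1 n] by (simp add: word_def)

lemma take_word: "k \<le> n \<Longrightarrow> take k (word x i n) = word x i k"
  by (simp add: word_def take_map)

lemma subseq_take_first_self: "subseq (take_first E s q) q"
  by (induction q) auto

text \<open>The only delicate case is a leading customer present in the longer list alone: if it is
  served, the longer list loses exactly this surplus, while the shorter one can only shrink.\<close>

lemma subseq_take_first: "subseq q q' \<Longrightarrow> subseq (take_first E s q) (take_first E s q')"
proof (induction rule: list_emb.induct)
  case (list_emb_Cons xs ys y)
  have "subseq (take_first E s xs) ys"
    using subseq_order.trans[OF subseq_take_first_self list_emb_Cons.hyps] .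
  with list_emb_Cons.IH show ?case by (auto intro: list_emb.intros)
next
  case (list_emb_Cons2 x y xs ys)
  then show ?case by simp
qed simp

lemma subseq_run: "subseq q q' \<Longrightarrow> subseq (run E q v) (run E q' v)"
proof (induction v arbitrary: q q')
  case (Cons a v)
  then show ?case by (cases a) (auto simp: subseq_take_first list_emb_append_mono)
qed simp

text \<open>The form in which monotonicity is mostly used: if the items empty the system from some
  initial list, they do so from the empty one.\<close>

lemma run_Nil_mono: "run E q v = [] \<Longrightarrow> run E [] v = []"
  using subseq_run[of "[]" q E v] by simp

definition waiting :: "(int \<Rightarrow> 'c + 's) \<Rightarrow> (int \<times> int) set \<Rightarrow> int \<Rightarrow> int \<Rightarrow> int set" where
  "waiting x A i t = {m \<in> {i..<t}. (\<exists>c. x m = Inl c) \<and> (\<forall>k<t. (m, k) \<notin> A)}"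

lemma take_first_map:
  assumes "sorted L" "distinct L" "earliest {m \<in> set L. (s, f m) \<in> E} d"
  shows "take_first E s (map f L) = map f (remove1 d L)"
  using assms
proof (induction L)
  case (Cons a L)
  show ?case
  proof (cases "(s, f a) \<in> E")
    case True
    have "earliest {m \<in> set (a # L). (s, f m) \<in> E} a"
      using True Cons.prems by (auto simp: earliest_def)
    then have "d = a" using Cons.prems earliest_unique by blast
    then show ?thesis using True by simp
  next
    case False
    then have "{m \<in> set (a # L). (s, f m) \<in> E} = {m \<in> set L. (s, f m) \<in> E}" by auto
    moreover have "d \<noteq> a" using Cons.prems False by (auto simp: earliest_def)
    ultimately show ?thesis using False Cons by simp
  qed
qed (auto simp: earliest_def)

lemma take_first_id: "(\<And>c. c \<in> set q \<Longrightarrow> (s, c) \<notin> E) \<Longrightarrow> take_first E s q = q"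
  by (induction q) auto

text \<open>Links matchings to the queue. Waiting positions listed in increasing order are customers
  in order of arrival, so the first compatible entry of the list is the earliest available
  customer.\<close>

lemma run_waiting:
  assumes A: "directed_fcfs E {i..} x A"
  shows "run E [] (word x i n) = map (\<lambda>m. projl (x m)) (sorted_list_of_set (waiting x A i (i + int n)))"
proof (induction n)
  case 0
  then show ?case by (simp add: waiting_def)
next
  case (Suc n)
  define t where "t = i + int n"
  let ?W = "waiting x A i t"
  let ?f = "\<lambda>m. projl (x m)"
  have t': "i + int (Suc n) = t + 1" by (simp add: t_def)
  have fin: "finite ?W" by (rule finite_subset[of _ "{i..<t}"]) (auto simp: waiting_def)
  have run: "run E [] (word x i (Suc n)) = step E (map ?f (sorted_list_of_set ?W)) (x t)"
    by (simp add: word_Suc Suc t_def)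
  show ?case
  proof (cases "x t")
    case (Inl c)
    then have "\<And>m. (m, t) \<notin> A" using directed_fcfsD(4)[OF A] by (force simp: compatible_at_def)
    moreover have "\<And>k. k < t + 1 \<Longrightarrow> (t, k) \<notin> A" using directed_fcfsD(3)[OF A] by force
    ultimately have "waiting x A i (t + 1) = insert t ?W"
      using Inl by (auto simp: waiting_def t_def order_le_less zless_add1_eq)
    moreover have "t \<notin> ?W" by (simp add: waiting_def)
    moreover have "insort t (sorted_list_of_set ?W) = sorted_list_of_set ?W @ [t]"
      using fin by (intro sorted_insort_is_snoc) (auto simp: waiting_def)
    ultimately show ?thesis using fin Inl unfolding t' run by simp
  next
    case (Inr s)
    have av: "available E {i..} x A t = {m \<in> ?W. (s, ?f m) \<in> E}"
      using Inr by (auto simp: available_def waiting_def compatible_at_def)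
    have W': "waiting x A i (t + 1) = ?W - {m. (m, t) \<in> A}"
      using Inr by (auto simp: waiting_def order_le_less zless_add1_eq)
    show ?thesis
    proof (cases "\<exists>d. (d, t) \<in> A")
      case True
      then obtain d where d: "(d, t) \<in> A" by blast
      have "{m. (m, t) \<in> A} = {d}" using d directed_fcfs_left_unique[OF A] by blast
      moreover have "earliest {m \<in> ?W. (s, ?f m) \<in> E} d"
        using directed_fcfs_earliest[OF A d] unfolding av .
      then have "take_first E s (map ?f (sorted_list_of_set ?W)) = map ?f (remove1 d (sorted_list_of_set ?W))"
        using fin by (intro take_first_map) auto
      ultimately show ?thesis using Inr W' fin unfolding t' run by (simp add: sorted_list_of_set_remove)
    next
      case False
      then have "{m \<in> ?W. (s, ?f m) \<in> E} = {}"
        using directed_fcfs_matched[OF A, of t] av by (auto simp: t_def)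
      then have "take_first E s (map ?f (sorted_list_of_set ?W)) = map ?f (sorted_list_of_set ?W)"
        using fin by (intro take_first_id) auto
      moreover have "{m. (m, t) \<in> A} = {}" using False by blast
      ultimately show ?thesis using Inr W' unfolding t' run by simp
    qed
  qed
qed

lemma cut_at_iff_run:
  assumes A: "directed_fcfs E {i..} x A"
  shows "cut_at {i..} x A (i + int n) \<longleftrightarrow> run E [] (word x i n) = []"
proof -
  have "finite (waiting x A i (i + int n))"
    by (rule finite_subset[of _ "{i..<i + int n}"]) (auto simp: waiting_def)
  then have "run E [] (word x i n) = [] \<longleftrightarrow> waiting x A i (i + int n) = {}"
    by (simp add: run_waiting[OF A])
  also have "\<dots> \<longleftrightarrow> cut_at {i..} x A (i + int n)"
    by (auto simp: waiting_def cut_at_def)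
  finally show ?thesis by simp
qed

text \<open>
  The system started empty at any earlier position is again empty at \<open>t\<close>; such positions are the
  regeneration points.
\<close>

definition empties_at :: "('s \<times> 'c) set \<Rightarrow> (int \<Rightarrow> 'c + 's) \<Rightarrow> int \<Rightarrow> bool" where
  "empties_at E x t \<longleftrightarrow> (\<forall>k. run E [] (word x (t - int k) k) = [])"

lemma empties_at_cut_half:
  assumes "empties_at E x t" "i \<le> t"
  shows "cut_at {i..} x (half_matching E i x) t"
proof -
  have "run E [] (word x i (nat (t - i))) = []"
    using assms(1)[unfolded empties_at_def, rule_format, of "nat (t - i)"] assms(2) by simp
  then show ?thesis
    using cut_at_iff_run[OF directed_fcfs_half[of E i x], of "nat (t - i)"] assms(2) by simp
qed

text \<open>Past a regeneration point the starting position is forgotten. This is what makes Loynes'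
  limit exist.\<close>

lemma half_matching_empties_at:
  assumes "empties_at E x i" "i' \<le> i"
  shows "half_matching E i x = {(m, n) \<in> half_matching E i' x. i \<le> m}"
proof -
  have "{i'..} \<inter> {i..} = {i..}" using assms by auto
  then show ?thesis
    using directed_fcfs_restrict_cut[OF directed_fcfs_half empties_at_cut_half[OF assms]]
    by (intro half_matching_eqI) simp
qed

lemma empties_at_iff_run:
  assumes "empties_at E x i"
  shows "empties_at E x (i + int n) \<longleftrightarrow> run E [] (word x i n) = []"
proof
  assume "empties_at E x (i + int n)"
  from this[unfolded empties_at_def, rule_format, of n] show "run E [] (word x i n) = []" by simp
next
  assume n: "run E [] (word x i n) = []"
  show "empties_at E x (i + int n)"
    unfolding empties_at_def
  proof
    fix k
    show "run E [] (word x (i + int n - int k) k) = []"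
    \<comment> \<open>A run starting after \<open>i\<close> is compared with the run from
      \<open>i\<close>, which reaches its starting position in some possibly nonempty state;
      monotonicity applies. A run starting before \<open>i\<close> is empty at \<open>i\<close> and
      continues as the run from \<open>i\<close>.\<close>
    proof (cases "k \<le> n")
      case True
      have "word x i n = word x i (n - k) @ word x (i + int n - int k) k"
        using word_add[of x i "n - k" k] True by (simp add: of_nat_diff algebra_simps)
      with n show ?thesis by (auto dest: run_Nil_mono)
    next
      case False
      have "word x (i + int n - int k) k = word x (i - int (k - n)) (k - n) @ word x i n"
        using word_add[of x "i - int (k - n)" "k - n" n] False by (simp add: of_nat_diff algebra_simps)
      with n assms show ?thesis by (simp add: empties_at_def)
    qed
  qed
qed

section \<open>Two-sided matchings with regeneration points\<close>

definition regenerative :: "('s \<times> 'c) set \<Rightarrow> (int \<Rightarrow> 'c + 's) \<Rightarrow> (int \<times> int) set \<Rightarrow> bool" where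
  "regenerative E x A \<longleftrightarrow> directed_fcfs E UNIV x A \<and>
     (\<forall>t. \<exists>i\<le>t. cut_at UNIV x A i) \<and> (\<forall>t. \<exists>i\<ge>t. cut_at UNIV x A i)"

lemma half_matching_cut:
  assumes "directed_fcfs E UNIV x A" "cut_at UNIV x A i"
  shows "half_matching E i x = {(m, n) \<in> A. i \<le> m}"
  using directed_fcfs_restrict_cut[OF assms] by (intro half_matching_eqI) simp

text \<open>Both directions compare with the half-line from a cut far enough in the past, where the
  two-sided matching and the half-line matching coincide.\<close>

lemma regenerative_empties_at_iff:
  assumes "regenerative E x A"
  shows "empties_at E x t \<longleftrightarrow> cut_at UNIV x A t"
proof
  assume emp: "empties_at E x t"
  show "cut_at UNIV x A t"
    unfolding cut_at_def
  proof (intro ballI allI impI)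
    fix m c assume m: "m < t" "x m = Inl c"
    from assms obtain i where i: "i \<le> m" "cut_at UNIV x A i" unfolding regenerative_def by blast
    have "cut_at {i..} x (half_matching E i x) t"
      using empties_at_cut_half[OF emp] i m by simp
    then obtain n where "n < t" "(m, n) \<in> half_matching E i x"
      unfolding cut_at_def using i m by (meson atLeast_iff)
    then show "\<exists>n<t. (m, n) \<in> A"
      using half_matching_cut[of E x A i] assms i unfolding regenerative_def by blast
  qed
next
  assume cut: "cut_at UNIV x A t"
  show "empties_at E x t"
    unfolding empties_at_def
  proof
    fix k
    from assms obtain i where i: "i \<le> t - int k" "cut_at UNIV x A i" unfolding regenerative_def by blast
    define l where "l = nat (t - int k - i)"
    have l: "i + int l = t - int k" using i by (simp add: l_def)
    have "cut_at {i..} x (half_matching E i x) t"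
      using cut half_matching_cut[of E x A i] assms i unfolding regenerative_def cut_at_def by auto
    then have "run E [] (word x i (l + k)) = []"
      using cut_at_iff_run[OF directed_fcfs_half[of E i x], of "l + k"] l by (simp add: add.assoc[symmetric])
    then show "run E [] (word x (t - int k) k) = []"
      using l by (auto simp: word_add dest: run_Nil_mono)
  qed
qed

text \<open>Cuts in the future force every customer to be matched; cuts in the past freeze the
  half-line matchings, which gives the limit.\<close>

lemma regenerative_two_sided:
  assumes "regenerative E x A"
  shows "two_sided_fcfs E x A"
proof -
  have A: "directed_fcfs E UNIV x A" using assms by (simp add: regenerative_def)
  have "covers_customers x A"
    unfolding covers_customers_def
  proof (intro allI impI)
    fix m c assume "x m = Inl c"
    moreover obtain i where "m + 1 \<le> i" "cut_at UNIV x A i" using assms unfolding regenerative_def by blast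
    ultimately show "\<exists>n. (m, n) \<in> A" unfolding cut_at_def by (metis UNIV_I zless_iff_Suc_zadd zle_iff_zadd add1_zle_eq)
  qed
  moreover have "loynes_limit E x A"
    unfolding loynes_limit_def
  proof (intro exI[of _ "\<lambda>k. half_matching E (- int k) x"] conjI allI directed_fcfs_half)
    fix m n
    obtain i where i: "i \<le> m" "cut_at UNIV x A i" using assms unfolding regenerative_def by blast
    then have emp: "empties_at E x i" using regenerative_empties_at_iff[OF assms] by blast
    show "\<forall>\<^sub>F k in sequentially. (m, n) \<in> half_matching E (- int k) x \<longleftrightarrow> (m, n) \<in> A"
      unfolding eventually_sequentially
    proof (intro exI allI impI)
      fix k assume "nat (- i) \<le> k"
      then have "- int k \<le> i" by linarith
      from half_matching_empties_at[OF emp this] half_matching_cut[OF A i(2)] i(1)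
      show "(m, n) \<in> half_matching E (- int k) x \<longleftrightarrow> (m, n) \<in> A" by blast
    qed
  qed
  ultimately show ?thesis using A by (simp add: two_sided_fcfs_def)
qed

text \<open>An explicit candidate for the limit, determined by \<open>x\<close> alone. Any Loynes
  limit must equal it, which gives uniqueness and later replaces the definite description when
  measurability is proved.\<close>

definition loynes :: "('s \<times> 'c) set \<Rightarrow> (int \<Rightarrow> 'c + 's) \<Rightarrow> (int \<times> int) set" where
  "loynes E x = {(m, n). \<forall>\<^sub>F k in sequentially. (m, n) \<in> half_matching E (- int k) x}"

lemma loynes_limit_eq:
  assumes "loynes_limit E x A"
  shows "A = loynes E x"
proof -
  from assms obtain B where B: "\<And>k. directed_fcfs E {- int k..} x (B k)"
    "\<And>m n. \<forall>\<^sub>F k in sequentially. (m, n) \<in> B k \<longleftrightarrow> (m, n) \<in> A"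
    unfolding loynes_limit_def by blast
  have "B k = half_matching E (- int k) x" for k using half_matching_eqI[OF B(1)] by simp
  then have *: "\<forall>\<^sub>F k in sequentially. (m, n) \<in> half_matching E (- int k) x \<longleftrightarrow> (m, n) \<in> A" for m n
    using B(2) by simp
  have "(m, n) \<in> A \<longleftrightarrow> (m, n) \<in> loynes E x" for m n
    unfolding loynes_def using eventually_subst[OF *[of m n]] by simp
  then show ?thesis by auto
qed

lemma two_sided_fcfs_unique:
  "two_sided_fcfs E x A \<Longrightarrow> two_sided_fcfs E x B \<Longrightarrow> A = B"
  using loynes_limit_eq unfolding two_sided_fcfs_def by blast

lemma the_matching_eq: "two_sided_fcfs E x A \<Longrightarrow> the_matching E x = A"
  unfolding the_matching_def by (rule the_equality, assumption, rule two_sided_fcfs_unique)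

lemma regenerative_the_matching: "regenerative E x A \<Longrightarrow> the_matching E x = A"
  by (simp add: regenerative_two_sided the_matching_eq)

text \<open>The half-line matchings started at regeneration points are restrictions of one another.
  Their union is therefore consistent, and it covers the whole line because regeneration points
  reach arbitrarily far into the past.\<close>

lemma ex_regenerative:
  assumes past: "\<And>t. \<exists>i\<le>t. empties_at E x i" and future: "\<And>t. \<exists>i\<ge>t. empties_at E x i"
  shows "\<exists>A. regenerative E x A"
proof -
  define A where "A = {(m, n). \<exists>i. empties_at E x i \<and> (m, n) \<in> half_matching E i x}"
  have ge: "i \<le> m" if "(m, n) \<in> half_matching E i x" for i m n
    using directed_fcfsD(1)[OF directed_fcfs_half that] by simp
  have A: "(m, n) \<in> A \<longleftrightarrow> (m, n) \<in> half_matching E i x" if i: "empties_at E x i" "i \<le> m" for i m n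
  proof
    assume "(m, n) \<in> A"
    then obtain i' where i': "empties_at E x i'" "(m, n) \<in> half_matching E i' x" unfolding A_def by blast
    show "(m, n) \<in> half_matching E i x"
    proof (cases "i' \<le> i")
      case True
      then show ?thesis using half_matching_empties_at[OF i(1) True] i i' by blast
    next
      case False
      then have "i \<le> i'" by simp
      from half_matching_empties_at[OF i'(1) this] i' show ?thesis by blast
    qed
  next
    assume "(m, n) \<in> half_matching E i x" with i show "(m, n) \<in> A" unfolding A_def by blast
  qed
  have cut: "cut_at UNIV x A i" if i: "empties_at E x i" for i
    unfolding cut_at_def
  proof (intro ballI allI impI)
    fix m c assume m: "m < i" "x m = Inl c"
    obtain i' where i': "i' \<le> m" "empties_at E x i'" using past by blast
    have "cut_at {i'..} x (half_matching E i' x) i"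
      using empties_at_cut_half[OF i] i' m by simp
    then obtain n where "n < i" "(m, n) \<in> half_matching E i' x"
      unfolding cut_at_def using i' m by (meson atLeast_iff)
    then show "\<exists>n<i. (m, n) \<in> A" using A[OF i'(2,1)] by blast
  qed
  have pair: "i \<le> m" if i: "empties_at E x i" "i \<le> n" and mn: "(m, n) \<in> A" for i m n
  proof (rule ccontr)
    assume m: "\<not> i \<le> m"
    from mn obtain i' where i': "empties_at E x i'" "(m, n) \<in> half_matching E i' x"
      unfolding A_def by blast
    then have "i' \<le> i" using ge m by force
    from cut_at_pair[OF directed_fcfs_half empties_at_cut_half[OF i(1) this] i'(2)] i m
    show False by simp
  qed
  \<comment> \<open>Customers before \<open>i\<close> are matched before \<open>i\<close>, so from
    \<open>i\<close> on the whole line offers the same candidates as the half-line.\<close>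
  have av: "available E UNIV x A n = available E {i..} x (half_matching E i x) n"
    if i: "empties_at E x i" "i \<le> n" for i n
  proof -
    have "i \<le> m" if "m \<in> available E UNIV x A n" for m
    proof (rule ccontr)
      assume "\<not> i \<le> m"
      with that cut[OF i(1)] obtain k where "k < i" "(m, k) \<in> A"
        unfolding cut_at_def available_def compatible_at_def by (auto simp: not_le)
      with that i show False unfolding available_def by auto
    qed
    then show ?thesis using A[OF i(1)] unfolding available_def by auto
  qed
  have "directed_fcfs E UNIV x A"
    unfolding directed_fcfs_iff
  proof (intro conjI allI ballI impI)
    fix m n
    obtain i where i: "empties_at E x i" "i \<le> n" using past by blast
    have "(m, n) \<in> A \<longleftrightarrow> (m, n) \<in> half_matching E i x"
      using A[OF i(1)] pair[OF i] ge by blast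
    also have "\<dots> \<longleftrightarrow> earliest (available E {i..} x (half_matching E i x) n) m"
      using directed_fcfs_half[of E i x] i unfolding directed_fcfs_iff by simp
    finally show "(m, n) \<in> A \<longleftrightarrow> n \<in> UNIV \<and> earliest (available E UNIV x A n) m"
      using av[OF i] by simp
  next
    fix n assume "available E UNIV x A n \<noteq> {}"
    moreover obtain i where i: "empties_at E x i" "i \<le> n" using past by blast
    ultimately obtain m where "(m, n) \<in> half_matching E i x"
      using directed_fcfs_matched[OF directed_fcfs_half, of n i E x] av[OF i] by auto
    with i(1) show "\<exists>m. (m, n) \<in> A" unfolding A_def by blast
  qed
  then have "regenerative E x A" unfolding regenerative_def using cut past future by meson
  then show ?thesis ..
qed

text \<open>The exchange is \<open>x\<close> composed with this map of positions. Fixing the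
  unmatched positions makes it an involution.\<close>

definition partner :: "(int \<times> int) set \<Rightarrow> int \<Rightarrow> int" where
  "partner A n = (if \<exists>m. (m, n) \<in> A \<or> (n, m) \<in> A then THE m. (m, n) \<in> A \<or> (n, m) \<in> A else n)"

lemma exchange_partner: "exchange A x n = x (partner A n)"
  by (simp add: exchange_def partner_def)

lemma partner_unmatched: "(\<And>m. (m, n) \<notin> A \<and> (n, m) \<notin> A) \<Longrightarrow> partner A n = n"
  by (simp add: partner_def)

lemma partner_pair:
  assumes A: "directed_fcfs E I x A" and mn: "(m, n) \<in> A"
  shows "partner A m = n" "partner A n = m"
proof -
  have cs: "(\<exists>c. x m' = Inl c) \<and> (\<exists>s. x n' = Inr s)" if "(m', n') \<in> A" for m' n'
    using directed_fcfsD(4)[OF A that] by (auto simp: compatible_at_def)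
  have 1: "k = n" if "(k, m) \<in> A \<or> (m, k) \<in> A" for k
    using that cs[of k m] cs[OF mn] directed_fcfs_right_unique[OF A mn] by auto
  have 2: "k = m" if "(k, n) \<in> A \<or> (n, k) \<in> A" for k
    using that cs[of n k] cs[OF mn] directed_fcfs_left_unique[OF A mn] by auto
  have "(THE k. (k, m) \<in> A \<or> (m, k) \<in> A) = n" using mn 1 by (intro the_equality) auto
  moreover have "(THE k. (k, n) \<in> A \<or> (n, k) \<in> A) = m" using mn 2 by (intro the_equality) auto
  ultimately show "partner A m = n" "partner A n = m" using mn unfolding partner_def by auto
qed

lemma partner_cases:
  assumes "directed_fcfs E I x A"
  obtains (server) "(partner A n, n) \<in> A" | (customer) "(n, partner A n) \<in> A"
    | (unmatched) "\<And>m. (m, n) \<notin> A" "\<And>m. (n, m) \<notin> A" "partner A n = n"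
proof (cases "\<exists>m. (m, n) \<in> A \<or> (n, m) \<in> A")
  case True
  then obtain m where "(m, n) \<in> A \<or> (n, m) \<in> A" by blast
  then show ?thesis using that(1,2) partner_pair[OF assms, of m n] partner_pair[OF assms, of n m] by auto
next
  case False
  then show ?thesis using that(3) partner_unmatched[of n A] by blast
qed

subsection \<open>Exchange and time reversal\<close>

lemma partner_partner: 
  assumes "directed_fcfs E I x A"
  shows "partner A (partner A n) = n"
  using assms
proof (cases rule: partner_cases[of E I x A n])
  case server
  then show ?thesis using partner_pair(1)[OF assms server] by simp
next
  case customer
  then show ?thesis using partner_pair(2)[OF assms customer] by simp
qed simp

text \<open>After the exchange the customer stands at the later position \<open>n\<close>, which
  becomes the earlier position \<open>-n\<close> in reversed time. Hence the swap together with the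
  signs.\<close>

definition reverse_matching :: "(int \<times> int) set \<Rightarrow> (int \<times> int) set" where
  "reverse_matching A = {(m, n). (- n, - m) \<in> A}"

lemma in_reverse_matching [simp]: "(m, n) \<in> reverse_matching A \<longleftrightarrow> (- n, - m) \<in> A"
  by (simp add: reverse_matching_def)

definition reversed :: "('s \<times> 'c) set \<Rightarrow> (int \<Rightarrow> 'c + 's) \<Rightarrow> int \<Rightarrow> 'c + 's" where
  "reversed E x n = exchange (the_matching E x) x (- n)"

text \<open>A server of the new sequence that overlooks an earlier compatible customer would betray
  an original server that preferred a later customer, or none, although an earlier compatible
  customer was waiting. Coverage ensures that every customer of the new sequence stems from a
  matched pair.\<close>

lemma directed_fcfs_reverse:
  assumes A: "directed_fcfs E UNIV x A" and cov: "covers_customers x A"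
  shows "directed_fcfs E UNIV (\<lambda>n. exchange A x (- n)) (reverse_matching A)"
proof -
  define y where "y = (\<lambda>n. exchange A x (- n))"
  define B where "B = reverse_matching A"
  have y: "y n = x (partner A (- n))" for n by (simp add: y_def exchange_partner)
  have customer: "\<exists>m. (m, - n) \<in> A \<and> x m = Inl c" if "y n = Inl c" for n c
    using A
  proof (cases rule: partner_cases[of E UNIV x A "- n"])
    case server
    then show ?thesis using that y by auto
  next
    case customer
    then show ?thesis using that y directed_fcfsD(4)[OF A customer] by (auto simp: compatible_at_def)
  next
    case unmatched
    then show ?thesis using that y cov unfolding covers_customers_def by metis
  qed
  have compat: "compatible_at E y (- n) (- m)" if "(m, n) \<in> A" for m n
    using directed_fcfsD(4)[OF A that] partner_pair[OF A that] by (auto simp: compatible_at_def y)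
  \<comment> \<open>The candidate \<open>k\<close> comes from an original pair
    \<open>(m, - k)\<close>. Being still unmatched before \<open>n\<close> in reversed time means
    \<open>m \<le> - n\<close>, so in the original sequence the customer at \<open>m\<close> arrived
    no later than position \<open>- n\<close>.\<close>
  have key: "\<exists>m c s. (m, - k) \<in> A \<and> m \<le> - n \<and> x m = Inl c \<and> y n = Inr s \<and> (s, c) \<in> E"
    if k: "k \<in> available E UNIV y B n" for k n
  proof -
    from k obtain c s where cs: "y k = Inl c" "y n = Inr s" "(s, c) \<in> E"
      and un: "\<And>l. (k, l) \<in> B \<Longrightarrow> \<not> l < n"
      unfolding available_def compatible_at_def by auto
    from customer[OF cs(1)] obtain m where m: "(m, - k) \<in> A" "x m = Inl c" by blast
    have "\<not> - m < n" using un[of "- m"] m by (simp add: B_def)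
    then show ?thesis using m cs by force
  qed
  have avail: "m \<in> available E UNIV x A q"
    if "(m, k) \<in> A" "m < q" "q < k" "x m = Inl c" "x q = Inr s" "(s, c) \<in> E" for m k q c s
  proof -
    have "\<not> l < q" if "(m, l) \<in> A" for l
      using directed_fcfs_right_unique[OF A \<open>(m, k) \<in> A\<close> that] \<open>q < k\<close> by simp
    then show ?thesis using that by (auto simp: available_def compatible_at_def)
  qed
  \<comment> \<open>If \<open>k\<close> preceded \<open>- q\<close>, the customer at
    \<open>m\<close> would have been waiting when the server at \<open>q\<close> chose the later
    customer at \<open>- n\<close>. The types match because \<open>y n\<close> is the item at
    \<open>q\<close>.\<close>
  have least: "- q \<le> k" if q: "(- n, q) \<in> A" and k: "k \<in> available E UNIV y B n" for q k n
  proof (rule ccontr)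
    assume "\<not> - q \<le> k"
    then have k': "q < - k" by simp
    from key[OF k] obtain m c s where m: "(m, - k) \<in> A" "m \<le> - n" "x m = Inl c" "y n = Inr s" "(s, c) \<in> E"
      by blast
    have "m \<noteq> - n" using directed_fcfs_right_unique[OF A q] m(1) k' by blast
    moreover have "x q = Inr s" using m(4) y[of n] partner_pair[OF A q] by simp
    moreover have "- n < q" using directed_fcfsD(3)[OF A q] .
    ultimately have "m \<in> available E UNIV x A q" using avail m k' by auto
    then have "- n \<le> m" using directed_fcfs_earliest[OF A q] unfolding earliest_def by blast
    with m \<open>m \<noteq> - n\<close> show False by simp
  qed
  have matched: "\<exists>q. (- n, q) \<in> A" if k: "k \<in> available E UNIV y B n" for k n
    using A
  proof (cases rule: partner_cases[of E UNIV x A "- n"])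
    case server
    from key[OF k] obtain s where "y n = Inr s" by blast
    then show ?thesis using server y[of n] directed_fcfsD(4)[OF A server] by (auto simp: compatible_at_def)
  next
    case unmatched
    from key[OF k] obtain m c s where m: "(m, - k) \<in> A" "m \<le> - n" "x m = Inl c" "y n = Inr s" "(s, c) \<in> E"
      by blast
    have "m \<noteq> - n" using m unmatched by blast
    moreover have "x (- n) = Inr s" using m(4) y[of n] unmatched(3) by simp
    moreover have "- n < - k" using k by (simp add: available_def)
    ultimately have "m \<in> available E UNIV x A (- n)" using avail m by auto
    then show ?thesis using directed_fcfs_matched[OF A, of "- n"] unmatched by blast
  qed blast
  have in_avail: "k \<in> available E UNIV y B n" if kn: "(k, n) \<in> B" for k n
  proof -
    have kn': "(- n, - k) \<in> A" using kn by (simp add: B_def)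
    have "\<not> l < n" if "(k, l) \<in> B" for l
      using directed_fcfs_left_unique[OF A kn', of "- l"] that by (auto simp: B_def)
    then show ?thesis
      using directed_fcfsD(3)[OF A kn'] compat[OF kn'] by (auto simp: available_def)
  qed
  have "(k, n) \<in> B \<longleftrightarrow> earliest (available E UNIV y B n) k" for k n
  proof
    assume kn: "(k, n) \<in> B"
    then show "earliest (available E UNIV y B n) k"
      using in_avail[OF kn] least[of n "- k"] by (simp add: earliest_def B_def)
  next
    assume k: "earliest (available E UNIV y B n) k"
    then obtain q where q: "(- n, q) \<in> A" using matched unfolding earliest_def by blast
    then have "(- q, n) \<in> B" by (simp add: B_def)
    moreover from in_avail[OF this] least[OF q] have "earliest (available E UNIV y B n) (- q)"
      by (simp add: earliest_def)
    ultimately show "(k, n) \<in> B" using earliest_unique[OF k] by simp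
  qed
  moreover have "\<exists>k. (k, n) \<in> B" if "available E UNIV y B n \<noteq> {}" for n
    using that matched[of _ n] by (metis B_def in_reverse_matching minus_minus all_not_in_conv)
  ultimately show ?thesis unfolding directed_fcfs_iff y_def[symmetric] B_def[symmetric] by simp
qed

lemma partner_reverse_matching:
  assumes A: "directed_fcfs E UNIV x A" and B: "directed_fcfs E UNIV y (reverse_matching A)"
  shows "partner (reverse_matching A) n = - partner A (- n)"
  using A
proof (cases rule: partner_cases[of E UNIV x A "- n"])
  case server
  then show ?thesis using partner_pair(1)[OF B, of n "- partner A (- n)"] by simp
next
  case customer
  then show ?thesis using partner_pair(2)[OF B, of "- partner A (- n)" n] by simp
next
  case unmatched
  then show ?thesis by (subst partner_unmatched) auto
qed

text \<open>Since \<open>reverse_matching A\<close> regenerates as well, it is the matching selected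
  for the new sequence; applying the construction twice thus composes \<open>partner A\<close> with
  itself.\<close>

lemma regenerative_reversed:
  assumes regenerative: "regenerative E x A"
  shows "regenerative E (reversed E x) (reverse_matching A)"
    and "reversed E (reversed E x) = x"
    and "empties_at E x i \<Longrightarrow> empties_at E (reversed E x) (1 - i)"
proof -
  have A: "directed_fcfs E UNIV x A" and cov: "covers_customers x A"
    using regenerative regenerative_two_sided[OF regenerative] by (simp_all add: regenerative_def two_sided_fcfs_def)
  have rev: "reversed E x = (\<lambda>n. exchange A x (- n))"
    by (simp add: reversed_def regenerative_the_matching[OF regenerative] fun_eq_iff)
  have B: "directed_fcfs E UNIV (reversed E x) (reverse_matching A)"
    unfolding rev by (rule directed_fcfs_reverse[OF A cov])
  \<comment> \<open>A cut at \<open>i\<close> lies between positions \<open>i - 1\<close> and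
    \<open>i\<close>; reflection sends these to \<open>1 - i\<close> and \<open>- i\<close>, so the
    reflected cut is at \<open>1 - i\<close>.\<close>
  have cut: "cut_at UNIV (reversed E x) (reverse_matching A) (1 - i)" if i: "cut_at UNIV x A i" for i
    unfolding cut_at_def
  proof (intro ballI allI impI)
    fix n c assume n: "n < 1 - i" "reversed E x n = Inl c"
    then have xp: "x (partner A (- n)) = Inl c" by (simp add: rev exchange_partner)
    have mn: "(partner A (- n), - n) \<in> A"
      using A
    proof (cases rule: partner_cases[of E UNIV x A "- n"])
      case customer
      then show ?thesis using directed_fcfsD(4)[OF A customer] xp by (auto simp: compatible_at_def)
    next
      case unmatched
      then show ?thesis using xp cov unfolding covers_customers_def by metis
    qed
    then have "i \<le> partner A (- n)" using cut_at_pair[OF A i mn] n by simp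
    then show "\<exists>k<1 - i. (n, k) \<in> reverse_matching A"
      using mn by (intro exI[of _ "- partner A (- n)"]) auto
  qed
  show regenerative': "regenerative E (reversed E x) (reverse_matching A)"
    unfolding regenerative_def
  proof (intro conjI B allI)
    fix t
    obtain i where i: "1 - t \<le> i" "cut_at UNIV x A i" using regenerative unfolding regenerative_def by blast
    then show "\<exists>i\<le>t. cut_at UNIV (reversed E x) (reverse_matching A) i"
      using cut[OF i(2)] by (intro exI[of _ "1 - i"]) auto
    obtain i where i: "1 - t \<ge> i" "cut_at UNIV x A i" using regenerative unfolding regenerative_def by blast
    then show "\<exists>i\<ge>t. cut_at UNIV (reversed E x) (reverse_matching A) i"
      using cut[OF i(2)] by (intro exI[of _ "1 - i"]) auto
  qed
  show "reversed E (reversed E x) = x"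
  proof
    fix n
    have "reversed E (reversed E x) n = exchange (reverse_matching A) (reversed E x) (- n)"
      unfolding reversed_def[of E "reversed E x"] regenerative_the_matching[OF regenerative'] ..
    also have "\<dots> = x (partner A (partner A n))"
      by (simp add: exchange_partner partner_reverse_matching[OF A B] rev)
    finally show "reversed E (reversed E x) n = x n" by (simp add: partner_partner[OF A])
  qed
  show "empties_at E (reversed E x) (1 - i)" if "empties_at E x i"
    using that cut regenerative_empties_at_iff[OF regenerative] regenerative_empties_at_iff[OF regenerative'] by blast
qed

section \<open>Locality of the exchange between regeneration points\<close>

lemma directed_fcfs_block:
  assumes A: "directed_fcfs E UNIV x A" and i: "cut_at UNIV x A i"
  shows "directed_fcfs E {i..<j} x {(m, n) \<in> A. i \<le> m \<and> n < j}"
proof -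
  have eq: "{(m, n) \<in> {(m, n) \<in> A. i \<le> m}. n < j} = {(m, n) \<in> A. i \<le> m \<and> n < j}"
    "UNIV \<inter> {i..} \<inter> {..<j} = {i..<j}"
    by auto
  show ?thesis
    using directed_fcfs_restrict_less[OF directed_fcfs_restrict_cut[OF A i], of j]
    unfolding eq .
qed

lemma partner_block:
  assumes A: "directed_fcfs E UNIV x A" and i: "cut_at UNIV x A i" and j: "cut_at UNIV x A j"
    and n: "n \<in> {i..<j}"
  shows "partner A n = partner {(m, n) \<in> A. i \<le> m \<and> n < j} n" "partner A n \<in> {i..<j}"
proof -
  let ?M = "{(m, n) \<in> A. i \<le> m \<and> n < j}"
  have M: "directed_fcfs E {i..<j} x ?M" by (rule directed_fcfs_block[OF A i])
  have in_M: "(m, k) \<in> ?M" if "(m, k) \<in> A" "m = n \<or> k = n" for m k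
    using that n cut_at_pair[OF A i that(1)] cut_at_pair[OF A j that(1)] by auto
  have "partner A n = partner ?M n \<and> partner A n \<in> {i..<j}"
    using A
  proof (cases rule: partner_cases[of E UNIV x A n])
    case server
    from in_M[OF server] have *: "(partner A n, n) \<in> ?M" by simp
    from partner_pair(2)[OF M this] directed_fcfsD(1)[OF M *] show ?thesis by simp
  next
    case customer
    from in_M[OF customer] have *: "(n, partner A n) \<in> ?M" by simp
    from partner_pair(1)[OF M this] directed_fcfsD(2)[OF M *] show ?thesis by simp
  next
    case unmatched
    then have "partner ?M n = n" by (intro partner_unmatched) auto
    then show ?thesis using unmatched(3) n by simp
  qed
  then show "partner A n = partner ?M n" "partner A n \<in> {i..<j}" by auto
qed

lemma word_eq_iff: "word x i n = word y i n \<longleftrightarrow> (\<forall>k\<in>{i..<i + int n}. x k = y k)"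
proof -
  have "{i..<i + int n} = (\<lambda>k. i + int k) ` {..<n}"
  proof (intro set_eqI iffI)
    fix k assume "k \<in> {i..<i + int n}"
    then show "k \<in> (\<lambda>k. i + int k) ` {..<n}" by (intro image_eqI[of _ _ "nat (k - i)"]) auto
  qed auto
  then show ?thesis by (auto simp: word_def)
qed

lemma mset_word: "mset (word x i n) = image_mset x (mset_set {i..<i + int n})"
proof -
  have "{i..<i + int n} = (\<lambda>k. i + int k) ` {0..<n}"
  proof (intro set_eqI iffI)
    fix k assume "k \<in> {i..<i + int n}"
    then show "k \<in> (\<lambda>k. i + int k) ` {0..<n}" by (intro image_eqI[of _ _ "nat (k - i)"]) auto
  qed auto
  moreover have "inj_on (\<lambda>k. i + int k) {0..<n}" by (auto simp: inj_on_def)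
  ultimately have "mset_set {i..<i + int n} = image_mset (\<lambda>k. i + int k) (mset_set {0..<n})"
    using image_mset_mset_set by metis
  then show ?thesis by (simp add: word_def image_mset.compositionality comp_def)
qed

text \<open>No pair leaves a block, and a finite block has only one matching. The exchanged block is
  thus a function of the block alone, whatever surrounds it.\<close>

lemma reversed_word_cong:
  assumes x: "regenerative E x A" and y: "regenerative E y B" and w: "word x i n = word y i n"
    and i: "empties_at E x i" "empties_at E y i"
    and j: "empties_at E x (i + int n)" "empties_at E y (i + int n)"
  shows "word (reversed E x) (1 - (i + int n)) n = word (reversed E y) (1 - (i + int n)) n"
proof -
  define j where "j = i + int n"
  have A: "directed_fcfs E UNIV x A" and B: "directed_fcfs E UNIV y B"
    using x y by (simp_all add: regenerative_def)
  have cutA: "cut_at UNIV x A i" "cut_at UNIV x A j" and cutB: "cut_at UNIV y B i" "cut_at UNIV y B j"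
    using assms regenerative_empties_at_iff by (auto simp: j_def)
  have eq: "x k = y k" if "k \<in> {i..<j}" for k using w that by (simp add: word_eq_iff j_def)
  have "{(m, n) \<in> A. i \<le> m \<and> n < j} = {(m, n) \<in> B. i \<le> m \<and> n < j}" (is "?M = ?N")
  proof (rule directed_fcfs_unique[of E "{i..<j}" x _ _ i])
    show "directed_fcfs E {i..<j} x ?M" by (rule directed_fcfs_block[OF A cutA(1)])
    show "directed_fcfs E {i..<j} x ?N"
      using directed_fcfs_block[OF B cutB(1)] directed_fcfs_cong[of "{i..<j}" x y E ?N] eq by blast
  qed auto
  then have "x (partner A k) = y (partner B k)" if "k \<in> {i..<j}" for k
    using partner_block[OF A cutA that] partner_block[OF B cutB that] eq by simp
  then show ?thesis
    unfolding word_eq_iff reversed_def regenerative_the_matching[OF x] regenerative_the_matching[OF y] exchange_partner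
    by (auto simp: j_def)
qed

text \<open>Partners stay inside the block, so the exchange only rearranges its items. This is why
  the probability of the word does not change.\<close>

lemma mset_reversed_word:
  assumes x: "regenerative E x A"
    and i: "empties_at E x i" and j: "empties_at E x (i + int n)"
  shows "mset (word (reversed E x) (1 - (i + int n)) n) = mset (word x i n)"
proof -
  have A: "directed_fcfs E UNIV x A" using x by (simp add: regenerative_def)
  have cut: "cut_at UNIV x A i" "cut_at UNIV x A (i + int n)"
    using assms regenerative_empties_at_iff by auto
  let ?J = "{i..<i + int n}" and ?J' = "{1 - (i + int n)..<1 - i}"
  have "bij_betw (\<lambda>k. partner A (- k)) ?J' ?J"
    by (rule bij_betw_byWitness[of _ "\<lambda>k. - partner A k"])
      (use partner_block(2)[OF A cut] in \<open>force simp: partner_partner[OF A]\<close>)+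
  then have J: "image_mset (\<lambda>k. partner A (- k)) (mset_set ?J') = mset_set ?J"
    by (metis bij_betw_imp_inj_on bij_betw_imp_surj_on image_mset_mset_set)
  have rev: "reversed E x = x \<circ> (\<lambda>k. partner A (- k))"
    by (simp add: reversed_def regenerative_the_matching[OF x] exchange_partner fun_eq_iff)
  have "mset (word (reversed E x) (1 - (i + int n)) n) = image_mset (reversed E x) (mset_set ?J')"
    by (simp add: mset_word)
  also have "\<dots> = image_mset x (image_mset (\<lambda>k. partner A (- k)) (mset_set ?J'))"
    unfolding rev image_mset.compositionality ..
  also have "\<dots> = mset (word x i n)"
    unfolding J mset_word ..
  finally show ?thesis .
qed

subsection \<open>The stationary queue\<close>

text \<open>The predecessors of a state under an effective service: the customer that left stood
  somewhere in front of the first remaining customer compatible with \<open>s\<close>, or anywhere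
  if there is none.\<close>

fun insertions :: "('s \<times> 'c) set \<Rightarrow> 's \<Rightarrow> 'c list \<Rightarrow> 'c list set" where
  "insertions E s [] = (\<lambda>d. [d]) ` {d. (s, d) \<in> E}"
| "insertions E s (c # q) = (\<lambda>d. d # c # q) ` {d. (s, d) \<in> E} \<union>
     (if (s, c) \<in> E then {} else (#) c ` insertions E s q)"

lemma finite_insertions [simp]: "finite (insertions E s (q :: 'c::finite list))"
  by (induction q) auto

lemma insertions_eq:
  "insertions E s q' = {q. s \<in> servers_of E (set q) \<and> take_first E s q = q'}"
proof (induction q')
  case Nil
  have "q \<in> insertions E s [] \<longleftrightarrow> s \<in> servers_of E (set q) \<and> take_first E s q = []" for q
    by (cases q) (auto simp: servers_of_def)
  then show ?case by blast
next
  case (Cons c q')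
  have "q \<in> insertions E s (c # q') \<longleftrightarrow> s \<in> servers_of E (set q) \<and> take_first E s q = c # q'" for q
    using Cons by (cases q) (auto simp: servers_of_def)
  then show ?case by blast
qed

locale matching_rates =
  fixes E :: "('s::finite \<times> 'c::finite) set" and lam :: "'c \<Rightarrow> real" and mu :: "'s \<Rightarrow> real"
  assumes lam_pos: "\<And>c. lam c > 0" and mu_pos: "\<And>s. mu s > 0"
    and stability: "\<And>C. C \<noteq> {} \<Longrightarrow> sum lam C < sum mu (servers_of E C)"
begin

definition service_rate :: "'c set \<Rightarrow> real" where
  "service_rate D = sum mu (servers_of E D)"

lemma service_rate_pos: "D \<noteq> {} \<Longrightarrow> service_rate D > 0"
  using stability[of D] sum_nonneg[of D lam] lam_pos unfolding service_rate_def
  by (meson le_less_trans less_imp_le)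

lemma service_rate_empty [simp]: "service_rate {} = 0"
  by (simp add: service_rate_def servers_of_def)

lemma service_rate_insert_pos [simp]: "service_rate (insert c D) > 0"
  by (simp add: service_rate_pos)

lemma service_rate_insert_nonzero [simp]: "service_rate (insert c D) \<noteq> 0"
  using service_rate_insert_pos[of c D] by linarith

text \<open>
  The queue is order independent: a state with set of types \<open>D\<close> is served at total rate
  \<open>service_rate D\<close>, whatever the order. Its stationary weight is \<open>weight {}\<close>; the prefix \<open>D\<close> is carried
  along for inductions from the front of the list.
\<close>

fun weight :: "'c set \<Rightarrow> 'c list \<Rightarrow> real" where
  "weight D [] = 1"
| "weight D (c # q) = lam c / service_rate (insert c D) * weight (insert c D) q"

lemma weight_pos: "weight D q > 0"
  by (induction q arbitrary: D) (auto simp: lam_pos)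

text \<open>For \<open>D = {}\<close> this is the second half of the balance: the flow out of
  \<open>q @ [c]\<close> through departures equals the flow into it from \<open>q\<close> by an
  arrival.\<close>

lemma weight_snoc:
  "weight D (q @ [c]) = weight D q * lam c / service_rate (insert c (D \<union> set q))"
  by (induction q arbitrary: D) (simp_all add: insert_commute)

text \<open>Adding \<open>d\<close> to \<open>D\<close> raises the service rate by the servers
  compatible with \<open>d\<close> but with nothing in \<open>D\<close>; exchanging the sums over
  servers and types counts these twice.\<close>

lemma sum_new_servers:
  "(\<Sum>s\<in>- servers_of E D. mu s * (\<Sum>d | (s, d) \<in> E. f d)) + service_rate D * (\<Sum>d\<in>UNIV. f d) =
     (\<Sum>d\<in>UNIV. service_rate (insert d D) * f d)"
proof -
  have ins: "servers_of E (insert d D) = servers_of E D \<union> {s \<in> - servers_of E D. (s, d) \<in> E}" for d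
    by (auto simp: servers_of_def)
  have rate: "service_rate (insert d D) = service_rate D + (\<Sum>s | s \<in> - servers_of E D \<and> (s, d) \<in> E. mu s)" for d
    unfolding service_rate_def ins by (subst sum.union_disjoint) auto
  have "(\<Sum>s\<in>- servers_of E D. mu s * (\<Sum>d | (s, d) \<in> E. f d)) =
      (\<Sum>s\<in>- servers_of E D. \<Sum>d\<in>UNIV. if (s, d) \<in> E then mu s * f d else 0)"
    by (simp add: sum_distrib_left sum.If_cases)
  also have "\<dots> = (\<Sum>d\<in>UNIV. \<Sum>s\<in>- servers_of E D. if (s, d) \<in> E then mu s * f d else 0)"
    by (rule sum.swap)
  also have "\<dots> = (\<Sum>d\<in>UNIV. (\<Sum>s | s \<in> - servers_of E D \<and> (s, d) \<in> E. mu s) * f d)"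
    by (simp add: sum_distrib_right sum.If_cases Collect_conj_eq Compl_eq)
  finally show ?thesis
    by (simp add: rate distrib_right sum.distrib sum_distrib_left)
qed

lemma sum_weight_insertions_Cons:
  "sum (weight D) (insertions E s (c # q)) = (\<Sum>d | (s, d) \<in> E. weight D (d # c # q)) +
     (if (s, c) \<in> E then 0
      else lam c / service_rate (insert c D) * sum (weight (insert c D)) (insertions E s q))"
proof -
  have 1: "sum (weight D) ((\<lambda>d. d # c # q) ` {d. (s, d) \<in> E}) = (\<Sum>d | (s, d) \<in> E. weight D (d # c # q))"
    by (subst sum.reindex) (auto simp: inj_on_def)
  have 2: "sum (weight D) ((#) c ` insertions E s q) =
      lam c / service_rate (insert c D) * sum (weight (insert c D)) (insertions E s q)"
    by (subst sum.reindex) (auto simp: inj_on_def sum_distrib_left)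
  show ?thesis
  proof (cases "(s, c) \<in> E")
    case True
    then show ?thesis by (simp add: 1[simplified])
  next
    case False
    then have "sum (weight D) (insertions E s (c # q)) =
        sum (weight D) ((\<lambda>d. d # c # q) ` {d. (s, d) \<in> E}) + sum (weight D) ((#) c ` insertions E s q)"
      by (simp, intro sum.union_disjoint) auto
    then show ?thesis using False 1 2 by simp
  qed
qed

text \<open>
  For \<open>D = {}\<close> the second summand vanishes and this is partial balance: the flow into \<open>q\<close> through
  departures equals the flow out of \<open>q\<close> through arrivals.
\<close>

lemma partial_balance:
  "(\<Sum>s\<in>- servers_of E D. mu s * sum (weight D) (insertions E s q)) +
     service_rate D * (\<Sum>d\<in>UNIV. weight D (d # q)) = sum lam UNIV * weight D q"
proof (induction q arbitrary: D)
  case Nil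
  have "sum (weight D) (insertions E s []) = (\<Sum>d | (s, d) \<in> E. weight D [d])" for s
    by (simp, subst sum.reindex) (auto simp: inj_on_def)
  then show ?case
    using sum_new_servers[where D = D and f = "\<lambda>d. weight D [d]"] by simp
next
  case (Cons c r)
  let ?D = "insert c D"
  let ?k = "lam c / service_rate ?D"
  \<comment> \<open>Servers that pass over the prefix and over \<open>c\<close> are exactly those
    new for the enlarged prefix, so the induction hypothesis applies with \<open>?D\<close>.\<close>
  have new: "- servers_of E ?D = {s \<in> - servers_of E D. (s, c) \<notin> E}"
    by (auto simp: servers_of_def)
  have "(\<Sum>s\<in>- servers_of E D. mu s * sum (weight D) (insertions E s (c # r))) =
      (\<Sum>s\<in>- servers_of E D. mu s * (\<Sum>d | (s, d) \<in> E. weight D (d # c # r))) +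
      (\<Sum>s\<in>- servers_of E D. if (s, c) \<in> E then 0 else ?k * (mu s * sum (weight ?D) (insertions E s r)))"
    unfolding sum_weight_insertions_Cons by (subst sum.distrib[symmetric], rule sum.cong) (auto simp: algebra_simps)
  also have "(\<Sum>s\<in>- servers_of E D. if (s, c) \<in> E then 0 else ?k * (mu s * sum (weight ?D) (insertions E s r))) =
      ?k * (\<Sum>s\<in>- servers_of E ?D. mu s * sum (weight ?D) (insertions E s r))"
    unfolding new sum.inter_filter[OF finite] by (subst sum_distrib_left, intro sum.cong) auto
  also have "(\<Sum>s\<in>- servers_of E ?D. mu s * sum (weight ?D) (insertions E s r)) =
      sum lam UNIV * weight ?D r - service_rate ?D * (\<Sum>d\<in>UNIV. weight ?D (d # r))"
    using Cons[of ?D] by simp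
  also have "?k * \<dots> = sum lam UNIV * weight D (c # r) - lam c * (\<Sum>d\<in>UNIV. weight ?D (d # r))"
    by (simp add: field_simps)
  \<comment> \<open>Interchanging the two leading customers \<open>c\<close> and \<open>d\<close>
    alters only the first denominator, since later ones depend on the set of types seen so
    far.\<close>
  also have "lam c * (\<Sum>d\<in>UNIV. weight ?D (d # r)) =
      (\<Sum>d\<in>UNIV. service_rate (insert d D) * weight D (d # c # r))"
    unfolding sum_distrib_left by (intro sum.cong refl) (simp add: insert_commute)
  finally show ?case
    using sum_new_servers[where D = D and f = "\<lambda>d. weight D (d # c # r)"] by linarith
qed

lemma sum_weight_le_Suc:
  "sum (weight D) {q. length q \<le> Suc n} =
     1 + (\<Sum>c\<in>UNIV. lam c / service_rate (insert c D) * sum (weight (insert c D)) {q. length q \<le> n})"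
proof -
  have fin: "finite {q :: 'c list. length q \<le> n}" for n
    using finite_lists_length_le[of "UNIV :: 'c set" n] by simp
  have "{q :: 'c list. length q \<le> Suc n} = insert [] (\<Union>c. (#) c ` {q. length q \<le> n})" (is "_ = insert _ ?U")
  proof (intro set_eqI)
    fix q :: "'c list"
    show "q \<in> {q. length q \<le> Suc n} \<longleftrightarrow> q \<in> insert [] ?U" by (cases q) auto
  qed
  moreover have "sum (weight D) ?U = (\<Sum>c\<in>UNIV. sum (weight D) ((#) c ` {q. length q \<le> n}))"
    by (rule sum.UNION_disjoint) (auto simp: fin)
  moreover have "sum (weight D) ((#) c ` {q. length q \<le> n}) =
      lam c / service_rate (insert c D) * sum (weight (insert c D)) {q. length q \<le> n}" for c
    by (subst sum.reindex) (auto simp: inj_on_def sum_distrib_left)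
  ultimately show ?thesis by (simp add: fin image_iff)
qed

text \<open>Induction on the number of types missing from the prefix. A next customer of a type in
  \<open>D\<close> leaves \<open>D\<close> unchanged and costs in total a factor
  \<open>\<rho> < 1\<close> by stability; any other type enlarges \<open>D\<close> and is covered by
  the induction hypothesis.\<close>

lemma sum_weight_bounded: "\<exists>C\<ge>0. \<forall>n. sum (weight D) {q. length q \<le> n} \<le> C"
proof (induction "card (- D)" arbitrary: D rule: less_induct)
  case less
  have "\<forall>c\<in>- D. \<exists>C\<ge>0. \<forall>n. sum (weight (insert c D)) {q. length q \<le> n} \<le> C"
    by (intro ballI less psubset_card_mono) auto
  then obtain C where C: "\<And>c. c \<in> - D \<Longrightarrow> C c \<ge> 0"
    "\<And>c n. c \<in> - D \<Longrightarrow> sum (weight (insert c D)) {q. length q \<le> n} \<le> C c"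
    by metis
  define \<rho> where "\<rho> = sum lam D / service_rate D"
  define B where "B = 1 + (\<Sum>c\<in>- D. lam c / service_rate (insert c D) * C c)"
  have \<rho>: "0 \<le> \<rho>" "\<rho> < 1"
    using stability[of D] service_rate_pos[of D] sum_nonneg[of D lam] lam_pos
    by (cases "D = {}"; auto simp: \<rho>_def service_rate_def less_imp_le)+
  have B: "1 \<le> B"
    unfolding B_def using C lam_pos by (auto intro!: sum_nonneg mult_nonneg_nonneg divide_nonneg_nonneg simp: less_imp_le)
  \<comment> \<open>The fixed point of the recursion \<open>T = B + \<rho> * T\<close> for the
    truncated sums. For \<open>D = {}\<close> the ratio \<open>\<rho>\<close> is
    \<open>0 / 0 = 0\<close>.\<close>
  let ?K = "B / (1 - \<rho>)"
  have K: "1 \<le> ?K" "B + \<rho> * ?K = ?K"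
    using \<rho> B by (auto simp: field_simps)
  have "sum (weight D) {q. length q \<le> n} \<le> ?K" for n
  proof (induction n)
    case 0
    then show ?case using K by simp
  next
    case (Suc n)
    let ?T = "\<lambda>D. sum (weight D) {q. length q \<le> n}"
    have "(\<Sum>c\<in>D. lam c / service_rate (insert c D) * ?T (insert c D)) = \<rho> * ?T D"
      by (simp add: insert_absorb \<rho>_def sum_divide_distrib sum_distrib_right)
    also have "\<dots> \<le> \<rho> * ?K" using Suc \<rho> by (intro mult_left_mono)
    finally have 1: "(\<Sum>c\<in>D. lam c / service_rate (insert c D) * ?T (insert c D)) \<le> \<rho> * ?K" .
    have 2: "(\<Sum>c\<in>- D. lam c / service_rate (insert c D) * ?T (insert c D)) \<le>
        (\<Sum>c\<in>- D. lam c / service_rate (insert c D) * C c)"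
      using C lam_pos by (intro sum_mono mult_left_mono) (auto simp: less_imp_le)
    have "sum (weight D) {q. length q \<le> Suc n} =
        1 + ((\<Sum>c\<in>D. lam c / service_rate (insert c D) * ?T (insert c D)) +
          (\<Sum>c\<in>- D. lam c / service_rate (insert c D) * ?T (insert c D)))"
      unfolding sum_weight_le_Suc by (subst sum.union_disjoint[symmetric]) auto
    also have "\<dots> \<le> B + \<rho> * ?K" using 1 2 unfolding B_def by linarith
    finally show ?case using K by simp
  qed
  then show ?case using K(1) by (intro exI[of _ ?K]) auto
qed

section \<open>Normalisation and invariance of the product form\<close>

definition total_weight :: ennreal where
  "total_weight = (\<integral>\<^sup>+ q. ennreal (weight {} q) \<partial>count_space UNIV)"

lemma total_weight_finite: "total_weight < \<top>"
proof -
  have fin: "finite {q :: 'c list. length q \<le> n}" for n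
    using finite_lists_length_le[of "UNIV :: 'c set" n] by simp
  obtain C where C: "\<And>n. sum (weight {}) {q. length q \<le> n} \<le> C"
    using sum_weight_bounded by blast
  define f where "f = (\<lambda>n q. ennreal (weight {} q) * indicator {q. length q \<le> n} q)"
  have "incseq f"
    by (auto simp: incseq_def le_fun_def f_def indicator_def)
  have "(SUP n. f n q) = ennreal (weight {} q)" for q
  proof (rule antisym)
    show "(SUP n. f n q) \<le> ennreal (weight {} q)"
      by (rule SUP_least) (auto simp: f_def indicator_def)
    show "ennreal (weight {} q) \<le> (SUP n. f n q)"
      by (rule SUP_upper2[of "length q"]) (auto simp: f_def)
  qed
  then have "total_weight = (\<integral>\<^sup>+ q. (SUP n. f n q) \<partial>count_space UNIV)"
    by (simp add: total_weight_def)
  also have "\<dots> = (SUP n. \<integral>\<^sup>+ q. f n q \<partial>count_space UNIV)"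
    using \<open>incseq f\<close> by (intro nn_integral_monotone_convergence_SUP) auto
  also have "\<dots> \<le> ennreal C"
  proof (rule SUP_least)
    fix n
    have "(\<integral>\<^sup>+ q. f n q \<partial>count_space UNIV) = (\<Sum>q | length q \<le> n. ennreal (weight {} q))"
      unfolding f_def by (subst nn_integral_count_space_indicator[symmetric]) (auto simp: nn_integral_count_space_finite fin)
    also have "\<dots> = ennreal (sum (weight {}) {q. length q \<le> n})"
      by (intro sum_ennreal) (simp add: weight_pos less_imp_le)
    also have "\<dots> \<le> ennreal C" using C by (intro ennreal_leI)
    finally show "(\<integral>\<^sup>+ q. f n q \<partial>count_space UNIV) \<le> ennreal C" .
  qed
  finally show ?thesis by (simp add: le_less_trans)
qed

lemma total_weight_pos: "0 < total_weight"
proof -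
  have "ennreal (weight {} []) \<le> total_weight"
    unfolding total_weight_def by (intro nn_integral_ge_point) auto
  then show ?thesis by (simp add: less_le_trans[of 0 1])
qed

definition stationary :: "'c list pmf" where
  "stationary = embed_pmf (\<lambda>q. weight {} q / enn2real total_weight)"

lemma enn2real_total_weight_pos: "0 < enn2real total_weight"
  using total_weight_finite total_weight_pos by (simp add: enn2real_positive_iff)

lemma pmf_stationary: "pmf stationary q = weight {} q / enn2real total_weight"
  unfolding stationary_def
proof (rule pmf_embed_pmf)
  let ?Z = "enn2real total_weight"
  have "(\<integral>\<^sup>+ q. ennreal (weight {} q / ?Z) \<partial>count_space UNIV) =
      (\<integral>\<^sup>+ q. ennreal (weight {} q) / ennreal ?Z \<partial>count_space UNIV)"
    using enn2real_total_weight_pos weight_pos by (simp add: divide_ennreal less_imp_le)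
  also have "\<dots> = total_weight / ennreal ?Z"
    unfolding total_weight_def by (rule nn_integral_divide) simp
  also have "\<dots> = 1"
    using total_weight_finite total_weight_pos by (simp add: ennreal_enn2real ennreal_divide_self)
  finally show "(\<integral>\<^sup>+ q. ennreal (weight {} q / ?Z) \<partial>count_space UNIV) = 1" .
qed (use enn2real_total_weight_pos weight_pos in \<open>simp add: less_imp_le\<close>)

definition total_rate :: real where
  "total_rate = sum lam UNIV + sum mu UNIV"

lemma total_rate_pos: "0 < total_rate"
  unfolding total_rate_def using lam_pos mu_pos by (intro add_pos_pos sum_pos) auto

definition item :: "('c + 's) pmf" where
  "item = embed_pmf (\<lambda>a. case a of Inl c \<Rightarrow> lam c / total_rate | Inr s \<Rightarrow> mu s / total_rate)"

lemma sum_items: "(\<Sum>a\<in>UNIV. f a) = (\<Sum>c\<in>UNIV. f (Inl c)) + (\<Sum>s\<in>UNIV. f (Inr s))"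
  for f :: "'c + 's \<Rightarrow> 'a::comm_monoid_add"
  by (simp add: UNIV_Plus_UNIV[symmetric] sum.Plus comp_def del: UNIV_Plus_UNIV)

lemma pmf_item: "pmf item a = (case a of Inl c \<Rightarrow> lam c / total_rate | Inr s \<Rightarrow> mu s / total_rate)"
  unfolding item_def
proof (rule pmf_embed_pmf)
  let ?f = "\<lambda>a. case a of Inl c \<Rightarrow> lam c / total_rate | Inr s \<Rightarrow> mu s / total_rate"
  have nonneg: "0 \<le> ?f a" for a
    using lam_pos mu_pos total_rate_pos by (auto simp: less_imp_le split: sum.split)
  then show "0 \<le> ?f a" for a .
  have "(\<integral>\<^sup>+ a. ennreal (?f a) \<partial>count_space UNIV) = ennreal (\<Sum>a\<in>UNIV. ?f a)"
    using nonneg by (simp add: nn_integral_count_space_finite sum_ennreal)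
  also have "(\<Sum>a\<in>UNIV. ?f a) = 1"
    using total_rate_pos unfolding sum_items
    by (simp add: sum_divide_distrib[symmetric] add_divide_distrib[symmetric] total_rate_def)
  finally show "(\<integral>\<^sup>+ a. ennreal (?f a) \<partial>count_space UNIV) = 1" by simp
qed

lemma pmf_item_pos: "0 < pmf item a"
  using lam_pos mu_pos total_rate_pos by (simp add: pmf_item split: sum.split)

text \<open>A state is entered by an arrival, an effective service or a lost service. Up to the
  normalising factors these contribute its weight times \<open>service_rate (set q')\<close>,
  \<open>sum lam UNIV\<close> and \<open>sum mu UNIV - service_rate (set q')\<close>, which add up
  to \<open>total_rate\<close>.\<close>

lemma stationary_invariant: "bind_pmf stationary (\<lambda>q. map_pmf (step E q) item) = stationary"
proof (rule pmf_eqI)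
  fix q' :: "'c list"
  let ?Z = "enn2real total_weight"
  have prob: "measure_pmf.prob stationary A = sum (weight {}) A / ?Z" if "finite A" for A
    by (simp add: measure_measure_pmf_finite[OF that] pmf_stationary sum_divide_distrib)
  have arrival: "(\<Sum>c\<in>UNIV. lam c * measure_pmf.prob stationary {q. q @ [c] = q'}) =
      service_rate (set q') * weight {} q' / ?Z"
  proof (cases q' rule: rev_cases)
    case Nil
    then show ?thesis by simp
  next
    case (snoc r d)
    have "{q. q @ [c] = q'} = (if c = d then {r} else {})" for c by (auto simp: snoc)
    then have "(\<Sum>c\<in>UNIV. lam c * measure_pmf.prob stationary {q. q @ [c] = q'}) =
        (\<Sum>c\<in>UNIV. if c = d then lam d * weight {} r / ?Z else 0)"
      by (intro sum.cong refl) (simp add: prob)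
    then show ?thesis by (simp add: snoc weight_snoc)
  qed
  \<comment> \<open>Either \<open>s\<close> removed a customer, or it found none compatible and left
    the state unchanged.\<close>
  have fibre: "{q. take_first E s q = q'} =
      insertions E s q' \<union> (if s \<in> servers_of E (set q') then {} else {q'})" for s
  proof -
    have "take_first E s q = q" if "s \<notin> servers_of E (set q)" for q
      using that by (intro take_first_id) (auto simp: servers_of_def)
    then show ?thesis unfolding insertions_eq by (auto; metis)
  qed
  have "measure_pmf.prob stationary {q. take_first E s q = q'} =
      (sum (weight {}) (insertions E s q') + (if s \<in> servers_of E (set q') then 0 else weight {} q')) / ?Z"
    for s
  proof (cases "s \<in> servers_of E (set q')")
    case False
    moreover have "q' \<notin> insertions E s q'" using False by (simp add: insertions_eq)
    ultimately show ?thesis by (simp add: fibre prob)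
  qed (simp add: fibre prob)
  then have "(\<Sum>s\<in>UNIV. mu s * measure_pmf.prob stationary {q. take_first E s q = q'}) =
      ((\<Sum>s\<in>UNIV. mu s * sum (weight {}) (insertions E s q')) +
       (\<Sum>s\<in>UNIV. if s \<in> servers_of E (set q') then 0 else mu s) * weight {} q') / ?Z"
    by (simp add: sum.distrib[symmetric] sum_distrib_right sum_divide_distrib)
      (intro sum.cong refl, simp add: algebra_simps)
  also have "(\<Sum>s\<in>UNIV. mu s * sum (weight {}) (insertions E s q')) = sum lam UNIV * weight {} q'"
    using partial_balance[of "{}" q'] by (simp add: servers_of_def)
  also have "(\<Sum>s\<in>UNIV. if s \<in> servers_of E (set q') then 0 else mu s) = sum mu UNIV - service_rate (set q')"
  proof -
    have "sum mu (- servers_of E (set q')) = sum mu UNIV - sum mu (servers_of E (set q'))"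
      by (simp add: Compl_eq_Diff_UNIV sum_diff)
    then show ?thesis by (simp add: sum.If_cases service_rate_def)
  qed
  finally have departure: "(\<Sum>s\<in>UNIV. mu s * measure_pmf.prob stationary {q. take_first E s q = q'}) =
      (sum lam UNIV * weight {} q' + (sum mu UNIV - service_rate (set q')) * weight {} q') / ?Z" .
  have "pmf (bind_pmf stationary (\<lambda>q. map_pmf (step E q) item)) q' =
      pmf (bind_pmf item (\<lambda>a. map_pmf (\<lambda>q. step E q a) stationary)) q'"
    unfolding map_pmf_def by (subst bind_commute_pmf) simp
  also have "\<dots> = (\<Sum>a\<in>UNIV. pmf item a * measure_pmf.prob stationary {q. step E q a = q'})"
    unfolding pmf_bind by (subst integral_measure_pmf[of UNIV]) (simp_all add: pmf_map vimage_def)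
  also have "\<dots> = ((\<Sum>c\<in>UNIV. lam c * measure_pmf.prob stationary {q. q @ [c] = q'}) +
      (\<Sum>s\<in>UNIV. mu s * measure_pmf.prob stationary {q. take_first E s q = q'})) / total_rate"
    unfolding sum_items by (simp add: pmf_item sum_divide_distrib add_divide_distrib)
  also have "\<dots> = (sum lam UNIV * weight {} q' + sum mu UNIV * weight {} q') / ?Z / total_rate"
    unfolding arrival departure by (simp add: add_divide_distrib[symmetric] left_diff_distrib)
  also have "\<dots> = pmf stationary q'"
    using total_rate_pos by (simp add: pmf_stationary distrib_right[symmetric] total_rate_def)
  finally show "pmf (bind_pmf stationary (\<lambda>q. map_pmf (step E q) item)) q' = pmf stationary q'" .
qed

end

subsection \<open>Regeneration points\<close>

lemma replicate_pmf_Suc: "replicate_pmf (Suc n) p = map_pmf (\<lambda>(a, v). a # v) (pair_pmf p (replicate_pmf n p))"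
  by (simp add: pair_pmf_def map_pmf_def bind_assoc_pmf bind_return_pmf)

lemma replicate_pmf_add:
  "replicate_pmf (m + n) p = map_pmf (\<lambda>(u, v). u @ v) (pair_pmf (replicate_pmf m p) (replicate_pmf n p))"
  by (simp add: replicate_pmf_distrib pair_pmf_def map_pmf_def bind_assoc_pmf bind_return_pmf)

lemma length_replicate_pmf: "v \<in> set_pmf (replicate_pmf n p) \<Longrightarrow> length v = n"
  by (simp add: set_replicate_pmf)

lemma pmf_replicate_pmf: "pmf (replicate_pmf (length v) p) v = (\<Prod>a\<in>#mset v. pmf p a)"
proof (induction v)
  case (Cons a v)
  have "pmf (replicate_pmf (Suc (length v)) p) (case (a, v) of (a, v) \<Rightarrow> a # v) =
      pmf (pair_pmf p (replicate_pmf (length v) p)) (a, v)"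
    unfolding replicate_pmf_Suc by (rule pmf_map_inj') (auto simp: inj_on_def)
  then show ?case by (simp add: pmf_pair Cons del: replicate_pmf.simps)
qed simp

lemma measure_replicate_pmf_append:
  "measure_pmf.prob (replicate_pmf (m + n) p) {v. take m v \<in> U \<and> drop m v \<in> V} =
     measure_pmf.prob (replicate_pmf m p) U * measure_pmf.prob (replicate_pmf n p) V"
  for p :: "'a::countable pmf"
proof -
  let ?q = "pair_pmf (replicate_pmf m p) (replicate_pmf n p)"
  have "measure_pmf.prob (replicate_pmf (m + n) p) {v. take m v \<in> U \<and> drop m v \<in> V} =
      measure_pmf.prob ?q {w. take m (fst w @ snd w) \<in> U \<and> drop m (fst w @ snd w) \<in> V}"
    unfolding replicate_pmf_add by (simp add: vimage_def case_prod_beta del: take_append drop_append)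
  also have "\<dots> = measure_pmf.prob ?q (U \<times> V)"
    by (rule measure_pmf.finite_measure_eq_AE) (auto intro!: AE_pmfI simp: set_replicate_pmf)
  also have "\<dots> = measure_pmf.prob (replicate_pmf m p) U * measure_pmf.prob (replicate_pmf n p) V"
    by (rule measure_pmf_prob_product) auto
  finally show ?thesis .
qed

lemma drop_word: "drop k (word x i (k + n)) = word x (i + int k) n"
  by (simp add: word_add)

section \<open>The canonical space of two-sided i.i.d. sequences\<close>

definition path_space :: "'a pmf \<Rightarrow> (int \<Rightarrow> 'a) measure" where
  "path_space p = PiM UNIV (\<lambda>_. measure_pmf p)"

lemma space_path_space [simp]: "space (path_space p) = UNIV"
  by (simp add: path_space_def space_PiM PiE_UNIV_domain)

lemma prob_space_path_space: "prob_space (path_space p)"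
  unfolding path_space_def by (intro prob_space_PiM measure_pmf.prob_space_axioms)

lemma measurable_coordinate [measurable]: "(\<lambda>x. x i) \<in> measurable (path_space p) (count_space UNIV)"
proof -
  have "(\<lambda>x. x i) \<in> measurable (path_space p) (measure_pmf p)"
    unfolding path_space_def by (rule measurable_component_singleton) simp
  then show ?thesis by simp
qed

lemma measurable_word [measurable]:
  "(\<lambda>x. word x i n) \<in> measurable (path_space p) (count_space (UNIV :: 'a::countable list set))"
proof -
  have "{x. word x i n = v} \<in> sets (path_space p)" for v
  proof (cases "length v = n")
    case True
    then have "{x. word x i n = v} = {x \<in> space (path_space p). \<forall>k\<in>{..<n}. x (i + int k) = v ! k}"
      by (auto simp: word_def list_eq_iff_nth_eq)
    also have "\<dots> \<in> sets (path_space p)" by measurable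
    finally show ?thesis .
  next
    case False
    then have "{x. word x i n = v} = {}" by auto
    then show ?thesis by simp
  qed
  then show ?thesis
    by (subst measurable_count_space_eq2_countable) (auto simp: vimage_def)
qed

lemma distr_word:
  "distr (path_space p) (count_space UNIV) (\<lambda>x. word x i n) = measure_pmf (replicate_pmf n p)"
  for p :: "'a::countable pmf"
proof (rule measure_eqI_countable[where A = UNIV])
  fix v :: "'a list"
  interpret product_prob_space "\<lambda>_ :: int. measure_pmf p" UNIV
    by (simp add: product_prob_spaceI measure_pmf.prob_space_axioms)
  have "emeasure (distr (path_space p) (count_space UNIV) (\<lambda>x. word x i n)) {v} =
      emeasure (path_space p) {x. word x i n = v}"
    by (subst emeasure_distr) (auto simp: vimage_def)
  also have "\<dots> = emeasure (measure_pmf (replicate_pmf n p)) {v}"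
  proof (cases "length v = n")
    case True
    let ?J = "{i..<i + int n}"
    have J: "?J = (\<lambda>k. i + int k) ` {..<n}"
    proof (intro set_eqI iffI)
      fix k assume "k \<in> ?J"
      then show "k \<in> (\<lambda>k. i + int k) ` {..<n}" by (intro image_eqI[of _ _ "nat (k - i)"]) auto
    qed auto
    have "{x. word x i n = v} = prod_emb UNIV (\<lambda>_. measure_pmf p) ?J (\<Pi>\<^sub>E k\<in>?J. {v ! nat (k - i)})"
      using True unfolding J by (auto simp: prod_emb_def word_def list_eq_iff_nth_eq PiE_iff)
    then have "emeasure (path_space p) {x. word x i n = v} = (\<Prod>k\<in>?J. emeasure (measure_pmf p) {v ! nat (k - i)})"
      unfolding path_space_def by (simp add: emeasure_PiM_emb)
    also have "\<dots> = (\<Prod>k<n. ennreal (pmf p (v ! k)))"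
      unfolding J by (subst prod.reindex) (auto simp: inj_on_def emeasure_pmf_single)
    also have "\<dots> = ennreal (\<Prod>k<n. pmf p (v ! k))"
      by (simp add: prod_ennreal)
    also have "(\<Prod>k<n. pmf p (v ! k)) = (\<Prod>a\<in>#mset v. pmf p a)"
      using True prod.list_conv_set_nth[of "map (pmf p) v"]
      by (simp add: atLeast0LessThan prod_mset_prod_list flip: mset_map)
    finally show ?thesis
      using pmf_replicate_pmf[of v p] True by (simp add: emeasure_pmf_single)
  next
    case False
    then have "{x. word x i n = v} = {}" by auto
    moreover have "v \<notin> set_pmf (replicate_pmf n p)" using False length_replicate_pmf by blast
    ultimately show ?thesis by (simp add: emeasure_pmf_single pmf_eq_0_set_pmf)
  qed
  finally show "emeasure (distr (path_space p) (count_space UNIV) (\<lambda>x. word x i n)) {v} =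
      emeasure (measure_pmf (replicate_pmf n p)) {v}" .
qed auto

lemma prob_word:
  "measure (path_space p) {x. word x i n \<in> V} = measure_pmf.prob (replicate_pmf n p) V"
  for p :: "'a::countable pmf"
proof -
  have "measure_pmf.prob (replicate_pmf n p) V =
      measure (distr (path_space p) (count_space UNIV) (\<lambda>x. word x i n)) V"
    by (simp add: distr_word)
  then show ?thesis by (simp add: measure_distr vimage_def)
qed

lemma prob_word_word:
  "measure (path_space p) {x. word x i m \<in> U \<and> word x (i + int m) n \<in> V} =
     measure_pmf.prob (replicate_pmf m p) U * measure_pmf.prob (replicate_pmf n p) V"
  for p :: "'a::countable pmf"
  using prob_word[where i = i and n = "m + n" and V = "{v. take m v \<in> U \<and> drop m v \<in> V}" and p = p]
  unfolding measure_replicate_pmf_append by (simp add: word_add)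

context matching_rates
begin

lemma stationary_run:
  "bind_pmf stationary (\<lambda>q. map_pmf (run E q) (replicate_pmf n item)) = stationary"
proof (induction n)
  case (Suc n)
  have "bind_pmf stationary (\<lambda>q. map_pmf (run E q) (replicate_pmf (Suc n) item)) =
      bind_pmf (bind_pmf stationary (\<lambda>q. map_pmf (step E q) item)) (\<lambda>q. map_pmf (run E q) (replicate_pmf n item))"
    by (simp add: map_pmf_def bind_assoc_pmf bind_return_pmf)
  then show ?case by (simp add: stationary_invariant Suc)
qed (simp add: bind_return_pmf')

text \<open>By invariance the left side is the probability that a stationary start is empty after
  \<open>n\<close> items, and starting empty only helps.\<close>

lemma prob_empty_ge: "pmf stationary [] \<le> measure_pmf.prob (replicate_pmf n item) {v. run E [] v = []}"
proof -
  have "pmf stationary [] =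
      measure_pmf.expectation stationary (\<lambda>q. measure_pmf.prob (replicate_pmf n item) {v. run E q v = []})"
    by (subst stationary_run[of n, symmetric]) (simp add: pmf_bind pmf_map vimage_def)
  also have "\<dots> \<le> measure_pmf.prob (replicate_pmf n item) {v. run E [] v = []}"
    by (intro measure_pmf.integral_le_const measure_pmf.integrable_const_bound[where B = 1] AE_I2
        measure_pmf.finite_measure_mono) (auto dest: run_Nil_mono)
  finally show ?thesis .
qed

abbreviation P where "P \<equiv> path_space item"

text \<open>The index \<open>k = 0\<close> is included, so the value is zero for
  \<open>q = []\<close>.\<close>

definition busy_prob :: "nat \<Rightarrow> 'c list \<Rightarrow> real" where
  "busy_prob n q = measure P {x. \<forall>k\<le>n. run E q (word x 0 k) \<noteq> []}"

lemma busy_prob_eq: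
  "busy_prob n q = measure_pmf.prob (replicate_pmf n item) {v. \<forall>k\<le>n. run E q (take k v) \<noteq> []}"
  unfolding busy_prob_def prob_word[where i = 0 and n = n, symmetric] by (simp add: take_word cong: all_cong)

text \<open>
  A run from the empty state stays below a run from any other state, hence below a stationary one.
\<close>

lemma busy_from_empty_le:
  "measure_pmf.prob (replicate_pmf (m + n) item) {v. \<forall>k\<le>n. run E [] (take (m + k) v) \<noteq> []} \<le>
     measure_pmf.expectation stationary (busy_prob n)"
proof -
  let ?b = "\<lambda>q v. \<forall>k\<le>n. run E q (take k v) \<noteq> []"
  let ?c = "\<lambda>q v. \<forall>k\<le>n. run E q (take (m + k) v) \<noteq> []"
  have "map_pmf (?c q) (replicate_pmf (m + n) item) =
      bind_pmf (replicate_pmf m item) (\<lambda>u. map_pmf (?b (run E q u)) (replicate_pmf n item))" for q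
    by (auto simp: replicate_pmf_distrib map_pmf_def bind_assoc_pmf bind_return_pmf
        dest!: length_replicate_pmf intro!: bind_pmf_cong)
  then have "bind_pmf stationary (\<lambda>q. map_pmf (?c q) (replicate_pmf (m + n) item)) =
      bind_pmf (bind_pmf stationary (\<lambda>q. map_pmf (run E q) (replicate_pmf m item)))
        (\<lambda>q. map_pmf (?b q) (replicate_pmf n item))"
    by (simp add: map_pmf_def bind_assoc_pmf bind_return_pmf)
  then have eq: "pmf (bind_pmf stationary (\<lambda>q. map_pmf (?c q) (replicate_pmf (m + n) item))) True =
      pmf (bind_pmf stationary (\<lambda>q. map_pmf (?b q) (replicate_pmf n item))) True"
    by (simp add: stationary_run)
  have "measure_pmf.prob (replicate_pmf (m + n) item) {v. ?c [] v} \<le>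
      measure_pmf.expectation stationary (\<lambda>q. measure_pmf.prob (replicate_pmf (m + n) item) {v. ?c q v})"
    by (intro measure_pmf.integral_ge_const measure_pmf.integrable_const_bound[where B = 1] AE_I2
        measure_pmf.finite_measure_mono) (auto dest: run_Nil_mono)
  also have "\<dots> = measure_pmf.expectation stationary (\<lambda>q. measure_pmf.prob (replicate_pmf n item) {v. ?b q v})"
    using eq by (simp add: pmf_bind pmf_map vimage_def)
  finally show ?thesis by (simp add: busy_prob_eq[abs_def])
qed

lemma measurable_empties_at [measurable]: "Measurable.pred P (\<lambda>x. empties_at E x t)"
proof -
  have [measurable]: "Measurable.pred P (\<lambda>x. run E q (word x i n) = [])" for q i n
    by (rule measurable_compose[OF measurable_word]) simp
  show ?thesis unfolding empties_at_def by measurable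
qed

definition empty_prob :: real where
  "empty_prob = measure P {x. empties_at E x 0}"

text \<open>Emptiness at \<open>t\<close> is the decreasing limit of emptiness for starts at
  \<open>t - k\<close>, and each of these events involves only the \<open>k\<close> items before
  \<open>t\<close>, independent of the word from \<open>t\<close> on.\<close>

lemma prob_empties_at_word_lim:
  "(\<lambda>k. measure_pmf.prob (replicate_pmf k item) {v. run E [] v = []} * measure_pmf.prob (replicate_pmf n item) V)
     \<longlonglongrightarrow> measure P {x. empties_at E x t \<and> word x t n \<in> V}"
proof -
  interpret prob_space P by (rule prob_space_path_space)
  define A where "A = (\<lambda>k. {x. run E [] (word x (t - int k) k) = [] \<and> word x t n \<in> V})"
  have [measurable]: "Measurable.pred P (\<lambda>x. run E q (word x i n) = [])" for q i n
    by (rule measurable_compose[OF measurable_word]) simp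
  have "A k \<in> sets P" for k
  proof -
    have "A k = {x \<in> space P. run E [] (word x (t - int k) k) = [] \<and> word x t n \<in> V}" by (simp add: A_def)
    also have "\<dots> \<in> sets P" by measurable
    finally show ?thesis .
  qed
  then have "range A \<subseteq> sets P" by blast
  moreover have "decseq A"
  proof (rule decseq_SucI)
    fix k
    have "word x (t - int (Suc k)) (Suc k) = x (t - int (Suc k)) # word x (t - int k) k" for x :: "int \<Rightarrow> 'c + 's"
      by (simp add: word_Suc')
    then show "A (Suc k) \<subseteq> A k" unfolding A_def by (auto dest: run_Nil_mono)
  qed
  ultimately have "(\<lambda>k. prob (A k)) \<longlonglongrightarrow> prob (\<Inter>k. A k)"
    by (intro finite_Lim_measure_decseq)
  moreover have "(\<Inter>k. A k) = {x. empties_at E x t \<and> word x t n \<in> V}"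
    by (auto simp: A_def empties_at_def)
  moreover have "prob (A k) = measure_pmf.prob (replicate_pmf k item) {v. run E [] v = []} *
      measure_pmf.prob (replicate_pmf n item) V" for k
    using prob_word_word[where i = "t - int k" and m = k and U = "{v. run E [] v = []}" and n = n and V = V and p = item]
    by (simp add: A_def)
  ultimately show ?thesis by simp
qed

lemma empty_prob_lim: "(\<lambda>k. measure_pmf.prob (replicate_pmf k item) {v. run E [] v = []}) \<longlonglongrightarrow> empty_prob"
  using prob_empties_at_word_lim[of 0 UNIV 0] by (simp add: empty_prob_def)

lemma prob_empties_at_word:
  "measure P {x. empties_at E x t \<and> word x t n \<in> V} = empty_prob * measure_pmf.prob (replicate_pmf n item) V"
  by (rule LIMSEQ_unique[OF prob_empties_at_word_lim]) (intro tendsto_mult_right empty_prob_lim)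

lemma empty_prob_pos: "0 < empty_prob"
proof -
  have "pmf stationary [] \<le> empty_prob"
    by (rule LIMSEQ_le_const[OF empty_prob_lim]) (use prob_empty_ge in blast)
  moreover have "0 < pmf stationary []"
    using enn2real_total_weight_pos weight_pos by (simp add: pmf_stationary)
  ultimately show ?thesis by simp
qed

lemma run_arrivals: "run E q (map Inl r) = q @ r"
  by (induction r arbitrary: q) auto

lemma busy_prob_antimono: "n \<le> m \<Longrightarrow> busy_prob m q \<le> busy_prob n q"
proof -
  assume "n \<le> m"
  interpret prob_space P by (rule prob_space_path_space)
  have [measurable]: "Measurable.pred P (\<lambda>x. run E q (word x i n) = [])" for q i n
    by (rule measurable_compose[OF measurable_word]) simp
  have "{x \<in> space P. \<forall>k\<le>n. run E q (word x 0 k) \<noteq> []} \<in> sets P" by measurable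
  with \<open>n \<le> m\<close> show ?thesis
    unfolding busy_prob_def by (intro finite_measure_mono) auto
qed

text \<open>
  The \<open>N\<close> events "the system is empty at \<open>s\<^sub>l\<close>, then the customers \<open>q\<close> arrive, then it stays busy", with
  \<open>s\<^sub>l\<close> spaced by \<open>length q + 1\<close>, are disjoint and equally likely.
\<close>

lemma busy_prob_bound:
  "real N * (empty_prob * pmf (replicate_pmf (length q) item) (map Inl q) * busy_prob (N * (length q + 1)) q) \<le> 1"
proof -
  interpret prob_space P by (rule prob_space_path_space)
  define L where "L = length q"
  \<comment> \<open>The horizon covers the distance between any two of the \<open>N\<close> starting
    times, so a busy spell after one of them excludes emptiness at every later one.\<close>
  define n where "n = N * (L + 1)"
  define V where "V = {v. take L v \<in> {map Inl q} \<and> drop L v \<in> {v. \<forall>k\<le>n. run E q (take k v) \<noteq> []}}"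
  define s where "s l = int (l * (L + 1))" for l :: nat
  define B where "B l = {x. empties_at E x (s l) \<and> word x (s l) (L + n) \<in> V}" for l
  have prob_B: "prob (B l) = empty_prob * pmf (replicate_pmf L item) (map Inl q) * busy_prob n q" for l
    unfolding B_def prob_empties_at_word V_def measure_replicate_pmf_append busy_prob_eq
    by (simp add: measure_pmf_single)
  have B_sets: "B l \<in> sets P" for l
  proof -
    have "B l = {x \<in> space P. empties_at E x (s l) \<and> word x (s l) (L + n) \<in> V}" by (simp add: B_def)
    also have "\<dots> \<in> sets P" by measurable
    finally show ?thesis .
  qed
  have disj: "B l \<inter> B l' = {}" if l: "l < l'" "l' < N" for l l'
  proof -
    have False if "x \<in> B l" "x \<in> B l'" for x
    proof -
      \<comment> \<open>The number of items between the end of the \<open>L\<close> arrivals after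
        \<open>s l\<close> and the time \<open>s l'\<close>. The spacing \<open>L + 1\<close> keeps
        the natural subtraction from truncating.\<close>
      define j where "j = (l' - l) * (L + 1) - L"
      have "1 * (L + 1) \<le> (l' - l) * (L + 1)" using l by (intro mult_le_mono1) auto
      then have j: "L + j = (l' - l) * (L + 1)" by (simp add: j_def)
      have "(l' - l) * (L + 1) \<le> N * (L + 1)" using l by (intro mult_le_mono1) auto
      then have jn: "j \<le> n" using j unfolding n_def by linarith
      have s': "s l' = s l + int (L + j)"
      proof -
        have "l' * (L + 1) = l * (L + 1) + (l' - l) * (L + 1)"
          using l by (simp only: distrib_right[symmetric]) simp
        then show ?thesis unfolding j s_def by (simp only: of_nat_add)
      qed
      have "empties_at E x (s l)" "empties_at E x (s l + int (L + j))"
        using that unfolding s'[symmetric] by (simp_all add: B_def)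
      then have "run E [] (word x (s l) (L + j)) = []"
        using empties_at_iff_run by blast
      moreover have "word x (s l) (L + j) = map Inl q @ take j (drop L (word x (s l) (L + n)))"
      proof -
        have "take L (word x (s l) (L + n)) = map Inl q" using that by (simp add: B_def V_def)
        then have "word x (s l) L = map Inl q" by (simp add: take_word)
        then show ?thesis using jn by (simp add: drop_word take_word word_add[of x _ L j])
      qed
      ultimately have "run E q (take j (drop L (word x (s l) (L + n)))) = []"
        by (simp add: run_arrivals)
      then show False using that jn unfolding B_def V_def by blast
    qed
    then show ?thesis by blast
  qed
  have "disjoint_family_on B {..<N}"
    unfolding disjoint_family_on_def using disj by (metis Int_commute lessThan_iff linorder_neqE_nat)
  then have "prob (\<Union>l<N. B l) = (\<Sum>l<N. prob (B l))"
    using B_sets by (intro finite_measure_finite_Union) auto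
  then have "(\<Sum>l<N. prob (B l)) \<le> 1" by (metis prob_le_1)
  then show ?thesis by (simp add: prob_B L_def n_def)
qed

text \<open>The preceding bound is \<open>1 / (N * c)\<close> along multiples of
  \<open>length q + 1\<close>, with \<open>c > 0\<close> independent of \<open>N\<close>;
  antitonicity fills the gaps.\<close>

lemma busy_prob_tendsto: "(\<lambda>n. busy_prob n q) \<longlonglongrightarrow> 0"
proof (rule LIMSEQ_I)
  fix r :: real assume r: "0 < r"
  define c where "c = empty_prob * pmf (replicate_pmf (length q) item) (map Inl q)"
  have "0 < (\<Prod>a\<in>#M. pmf item a)" for M
    by (induction M) (simp_all add: pmf_item_pos)
  then have "0 < pmf (replicate_pmf (length q) item) (map Inl q)"
    using pmf_replicate_pmf[of "map Inl q" item] by simp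
  then have c: "0 < c" using empty_prob_pos by (simp add: c_def)
  obtain N where N: "1 / (r * c) < real N" using reals_Archimedean2 by blast
  then have N': "1 < real N * c * r" using r c by (simp add: field_simps)
  define n0 where "n0 = N * (length q + 1)"
  have "real N * c * busy_prob n0 q \<le> 1"
    using busy_prob_bound[of N q] by (simp add: c_def n0_def mult_ac)
  with N' have "real N * c * busy_prob n0 q < real N * c * r" by linarith
  then have lt: "busy_prob n0 q < r" using c by (simp add: mult_less_cancel_left)
  show "\<exists>n0. \<forall>n\<ge>n0. norm (busy_prob n q - 0) < r"
  proof (intro exI allI impI)
    fix n assume "n0 \<le> n"
    then show "norm (busy_prob n q - 0) < r"
      using lt busy_prob_antimono[of n0 n q] by (simp add: busy_prob_def)
  qed
qed

lemma expectation_busy_prob_tendsto: "(\<lambda>n. measure_pmf.expectation stationary (busy_prob n)) \<longlonglongrightarrow> 0"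
proof -
  interpret prob_space P by (rule prob_space_path_space)
  have "(\<lambda>n. measure_pmf.expectation stationary (busy_prob n)) \<longlonglongrightarrow>
      measure_pmf.expectation stationary (\<lambda>_. 0)"
    by (rule integral_dominated_convergence[where w = "\<lambda>_. 1"])
      (use busy_prob_tendsto in \<open>auto simp: busy_prob_eq\<close>)
  then show ?thesis by simp
qed

text \<open>The estimate does not depend on \<open>t\<close>: a system started empty at
  \<open>t - k\<close> is dominated by one stationary at that time, and the latter is still
  stationary at \<open>t\<close>.\<close>

lemma prob_no_empty_le:
  "measure P {x. \<forall>j\<le>n. \<not> empties_at E x (t + int j)} \<le> measure_pmf.expectation stationary (busy_prob n)"
proof -
  interpret prob_space P by (rule prob_space_path_space)
  have [measurable]: "Measurable.pred P (\<lambda>x. run E q (word x i n) = [])" for q i n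
    by (rule measurable_compose[OF measurable_word]) simp
  define C where "C k = {x. \<forall>j\<le>n. run E [] (word x (t - int k) (k + j)) \<noteq> []}" for k
  have C_sets: "C k \<in> sets P" for k
  proof -
    have "C k = {x \<in> space P. \<forall>j\<le>n. run E [] (word x (t - int k) (k + j)) \<noteq> []}" by (simp add: C_def)
    also have "\<dots> \<in> sets P" by measurable
    finally show ?thesis .
  qed
  have mono: "run E [] (word x (t - int k) (k + j)) \<noteq> []"
    if "run E [] (word x (t + int j - int l) l) \<noteq> []" "l \<le> k + j" for x k j l
  proof -
    have "word x (t - int k) ((k + j - l) + l) = word x (t - int k) (k + j - l) @ word x (t + int j - int l) l"
      unfolding word_add using that(2) by (simp add: of_nat_diff algebra_simps)
    then show ?thesis using that by (auto dest: run_Nil_mono)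
  qed
  have "incseq C"
    unfolding incseq_def
  proof (intro allI impI subsetI)
    fix k k' x assume "k \<le> k'" "x \<in> C k"
    then show "x \<in> C k'"
      unfolding C_def
    proof (intro CollectI allI impI)
      fix j assume "j \<le> n"
      with \<open>x \<in> C k\<close> have "run E [] (word x (t + int j - int (k + j)) (k + j)) \<noteq> []"
        by (simp add: C_def)
      from mono[OF this] \<open>k \<le> k'\<close> show "run E [] (word x (t - int k') (k' + j)) \<noteq> []" by simp
    qed
  qed
  then have "(\<lambda>k. prob (C k)) \<longlonglongrightarrow> prob (\<Union>k. C k)"
    using C_sets by (intro finite_Lim_measure_incseq) auto
  moreover have "prob (C k) \<le> measure_pmf.expectation stationary (busy_prob n)" for k
  proof -
    have "C k = {x. word x (t - int k) (k + n) \<in> {v. \<forall>j\<le>n. run E [] (take (k + j) v) \<noteq> []}}"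
      unfolding C_def by (simp add: take_word cong: all_cong)
    then show ?thesis using busy_from_empty_le[of k n] by (simp only: prob_word)
  qed
  ultimately have le: "prob (\<Union>k. C k) \<le> measure_pmf.expectation stationary (busy_prob n)"
    by (intro LIMSEQ_le_const2) auto
  have "{x. \<forall>j\<le>n. \<not> empties_at E x (t + int j)} \<subseteq> (\<Union>k. C k)"
  proof
    fix x assume "x \<in> {x. \<forall>j\<le>n. \<not> empties_at E x (t + int j)}"
    then have "\<forall>j. \<exists>l. j \<le> n \<longrightarrow> run E [] (word x (t + int j - int l) l) \<noteq> []"
      unfolding empties_at_def by blast
    then obtain l where l: "\<And>j. j \<le> n \<Longrightarrow> run E [] (word x (t + int j - int (l j)) (l j)) \<noteq> []"
      by metis
    \<comment> \<open>Each time in the window has its own witnessing start. Starting earlier keeps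
      the system nonempty, so one start before all the finitely many witnesses serves them
      together.\<close>
    have "x \<in> C (Max (l ` {..n}))"
      unfolding C_def
    proof (intro CollectI allI impI)
      fix j assume j: "j \<le> n"
      then have "l j \<le> Max (l ` {..n}) + j" by (simp add: trans_le_add1)
      from mono[OF l[OF j] this] show "run E [] (word x (t - int (Max (l ` {..n}))) (Max (l ` {..n}) + j)) \<noteq> []" .
    qed
    then show "x \<in> (\<Union>k. C k)" by blast
  qed
  then have "measure P {x. \<forall>j\<le>n. \<not> empties_at E x (t + int j)} \<le> prob (\<Union>k. C k)"
    using C_sets by (intro finite_measure_mono) auto
  with le show ?thesis by linarith
qed

lemma AE_empties_at: "AE x in P. \<forall>t. (\<exists>i\<le>t. empties_at E x i) \<and> (\<exists>i\<ge>t. empties_at E x i)"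
proof -
  interpret prob_space P by (rule prob_space_path_space)
  \<comment> \<open>An event contained, for every \<open>n\<close>, in the absence of regeneration
    on some window of length \<open>n + 1\<close> is null, wherever the windows lie. Windows ending
    at \<open>t\<close> treat the past, windows beginning at \<open>t\<close> the future.\<close>
  have null: "AE x in P. \<not> Q x"
    if Q: "\<And>n. \<exists>t. {x. Q x} \<subseteq> {x. \<forall>j\<le>n. \<not> empties_at E x (t + int j)}" "Measurable.pred P Q" for Q
  proof -
    have [measurable]: "Measurable.pred P Q" by fact
    have sets: "{x. \<forall>j\<le>n. \<not> empties_at E x (t + int j)} \<in> sets P" for n t
    proof -
      have "{x \<in> space P. \<forall>j\<le>n. \<not> empties_at E x (t + int j)} \<in> sets P" by measurable
      then show ?thesis by simp
    qed
    have "prob {x. Q x} \<le> measure_pmf.expectation stationary (busy_prob n)" for n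
    proof -
      obtain t where "{x. Q x} \<subseteq> {x. \<forall>j\<le>n. \<not> empties_at E x (t + int j)}" using Q by blast
      then have "prob {x. Q x} \<le> prob {x. \<forall>j\<le>n. \<not> empties_at E x (t + int j)}"
        using sets by (intro finite_measure_mono) auto
      then show ?thesis using prob_no_empty_le[of n t] by linarith
    qed
    then have "prob {x. Q x} \<le> 0"
      by (intro LIMSEQ_le_const[OF expectation_busy_prob_tendsto]) auto
    then have "prob {x \<in> space P. Q x} = 0" by (simp add: measure_le_0_iff)
    moreover have "{x \<in> space P. Q x} \<in> sets P" by measurable
    ultimately show ?thesis using prob_eq_0[of "{x \<in> space P. Q x}"] by simp
  qed
  have "AE x in P. \<not> (\<forall>i\<le>t. \<not> empties_at E x i)" for t
  proof (rule null)
    fix n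
    show "\<exists>t'. {x. \<forall>i\<le>t. \<not> empties_at E x i} \<subseteq> {x. \<forall>j\<le>n. \<not> empties_at E x (t' + int j)}"
      by (intro exI[of _ "t - int n"]) auto
  qed measurable
  moreover have "AE x in P. \<not> (\<forall>i\<ge>t. \<not> empties_at E x i)" for t
  proof (rule null)
    fix n
    show "\<exists>t'. {x. \<forall>i\<ge>t. \<not> empties_at E x i} \<subseteq> {x. \<forall>j\<le>n. \<not> empties_at E x (t' + int j)}"
      by (intro exI[of _ t]) auto
  qed measurable
  ultimately show ?thesis by (simp add: AE_all_countable)
qed

lemma AE_regenerative: "AE x in P. \<exists>A. regenerative E x A"
  using AE_empties_at by eventually_elim (blast intro: ex_regenerative)

end

subsection \<open>The law of the exchanged sequence\<close>

lemma regenerative_ex1_two_sided: "regenerative E x A \<Longrightarrow> \<exists>!A. two_sided_fcfs E x A"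
  by (rule ex1I[of _ A], rule regenerative_two_sided, assumption, rule two_sided_fcfs_unique[OF _ regenerative_two_sided])

section \<open>Measurability of the matching and of the exchange\<close>

lemma half_matching_cong:
  assumes "\<And>k. i \<le> k \<Longrightarrow> k \<le> n \<Longrightarrow> x k = y k"
  shows "(m, n) \<in> half_matching E i x \<longleftrightarrow> (m, n) \<in> half_matching E i y"
proof -
  let ?R = "\<lambda>x. {(m, n') \<in> half_matching E i x. n' < n + 1}"
  have R: "directed_fcfs E ({i..} \<inter> {..<n + 1}) x (?R x)" for x
    by (rule directed_fcfs_restrict_less[OF directed_fcfs_half])
  have "directed_fcfs E ({i..} \<inter> {..<n + 1}) x (?R y)"
    using R[of y] by (subst directed_fcfs_cong[of _ x y]) (use assms in auto)
  then have "?R x = ?R y"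
    by (rule directed_fcfs_unique[OF R]) auto
  then have "(m, n) \<in> ?R x \<longleftrightarrow> (m, n) \<in> ?R y" by (rule arg_cong)
  then show ?thesis by simp
qed

lemma measurable_half_matching [measurable]:
  "Measurable.pred (path_space p) (\<lambda>x. (m, n) \<in> half_matching E i x)"
  for p :: "('c::countable + 's::countable) pmf"
proof (cases "i \<le> n")
  case True
  define N where "N = nat (n - i + 1)"
  have "(m, n) \<in> half_matching E i x \<longleftrightarrow>
      (m, n) \<in> half_matching E i (\<lambda>k. word x i N ! nat (k - i))" for x :: "int \<Rightarrow> 'c + 's"
    using True by (intro half_matching_cong) (auto simp: N_def word_def)
  moreover have "Measurable.pred (path_space p) (\<lambda>x. (m, n) \<in> half_matching E i (\<lambda>k. word x i N ! nat (k - i)))"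
    by (rule measurable_compose[OF measurable_word]) simp
  ultimately show ?thesis by (simp only:)
next
  case False
  then have "(m, n) \<notin> half_matching E i x" for x :: "int \<Rightarrow> 'c + 's"
    using directed_fcfsD(2)[OF directed_fcfs_half] by force
  then show ?thesis by simp
qed

lemma measurable_loynes [measurable]:
  "Measurable.pred (path_space p) (\<lambda>x. (m, n) \<in> loynes E x)"
  for p :: "('c::countable + 's::countable) pmf"
  unfolding loynes_def mem_Collect_eq case_prod_conv eventually_sequentially by measurable

lemma loynes_limit_loynes_iff:
  "loynes_limit E x (loynes E x) \<longleftrightarrow>
     (\<forall>m n. \<forall>\<^sub>F k in sequentially. (m, n) \<in> half_matching E (- int k) x \<longleftrightarrow> (m, n) \<in> loynes E x)"
proof
  assume "loynes_limit E x (loynes E x)"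
  then obtain B where B: "\<And>k. directed_fcfs E {- int k..} x (B k)"
    "\<And>m n. \<forall>\<^sub>F k in sequentially. (m, n) \<in> B k \<longleftrightarrow> (m, n) \<in> loynes E x"
    unfolding loynes_limit_def by blast
  have "B k = half_matching E (- int k) x" for k using half_matching_eqI[OF B(1)] by simp
  then show "\<forall>m n. \<forall>\<^sub>F k in sequentially. (m, n) \<in> half_matching E (- int k) x \<longleftrightarrow> (m, n) \<in> loynes E x"
    using B(2) by simp
next
  assume "\<forall>m n. \<forall>\<^sub>F k in sequentially. (m, n) \<in> half_matching E (- int k) x \<longleftrightarrow> (m, n) \<in> loynes E x"
  then show "loynes_limit E x (loynes E x)"
    unfolding loynes_limit_def using directed_fcfs_half
    by (intro exI[of _ "\<lambda>k. half_matching E (- int k) x"]) blast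
qed

text \<open>With the explicit \<open>loynes\<close> in place of an unknown matching, every clause is
  a countable combination of events about finite words.\<close>

lemma measurable_two_sided_loynes [measurable]:
  "Measurable.pred (path_space p) (\<lambda>x. two_sided_fcfs E x (loynes E x))"
  for p :: "('c::countable + 's::countable) pmf"
proof -
  have [measurable]: "Measurable.pred (path_space p) (\<lambda>x. compatible_at E x m n)" for m n
    unfolding compatible_at_def by measurable
  have [measurable]: "Measurable.pred (path_space p) (\<lambda>x. m \<in> available E UNIV x (loynes E x) n)" for m n
    unfolding available_def mem_Collect_eq by measurable
  have eq: "two_sided_fcfs E x (loynes E x) \<longleftrightarrow>
      ((\<forall>m n. (m, n) \<in> loynes E x \<longleftrightarrow> m \<in> available E UNIV x (loynes E x) n \<and>
          (\<forall>m'. m' \<in> available E UNIV x (loynes E x) n \<longrightarrow> m \<le> m')) \<and>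
       (\<forall>n. (\<exists>m. m \<in> available E UNIV x (loynes E x) n) \<longrightarrow> (\<exists>m. (m, n) \<in> loynes E x))) \<and>
      (\<forall>m c. x m = Inl c \<longrightarrow> (\<exists>n. (m, n) \<in> loynes E x)) \<and>
      (\<forall>m n. \<exists>N. \<forall>k\<ge>N. (m, n) \<in> half_matching E (- int k) x \<longleftrightarrow> (m, n) \<in> loynes E x)"
    for x :: "int \<Rightarrow> 'c + 's"
    unfolding two_sided_fcfs_def directed_fcfs_iff covers_customers_def loynes_limit_loynes_iff
      eventually_sequentially earliest_def by blast
  show ?thesis unfolding eq by measurable
qed

text \<open>
  Off the set where a matching exists, \<open>the_matching\<close> is the constant \<open>THE A. False\<close>, so that the
  exchanged sequence is measurable everywhere, not only almost everywhere.
\<close>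

lemma reversed_eq_iff:
  "reversed E x n = a \<longleftrightarrow>
     (if two_sided_fcfs E x (loynes E x)
      then (\<exists>m. ((m, - n) \<in> loynes E x \<or> (- n, m) \<in> loynes E x) \<and> x m = a) \<or>
        (\<forall>m. (m, - n) \<notin> loynes E x \<and> (- n, m) \<notin> loynes E x) \<and> x (- n) = a
      else x (partner (THE A. False) (- n)) = a)"
proof (cases "two_sided_fcfs E x (loynes E x)")
  case True
  then have A: "directed_fcfs E UNIV x (loynes E x)" by (simp add: two_sided_fcfs_def)
  have rev: "reversed E x n = x (partner (loynes E x) (- n))"
    by (simp add: reversed_def exchange_partner the_matching_eq[OF True])
  show ?thesis
    using A
  proof (cases rule: partner_cases[of E UNIV x "loynes E x" "- n"])
    case server
    then have "m = partner (loynes E x) (- n)" if "(m, - n) \<in> loynes E x \<or> (- n, m) \<in> loynes E x" for m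
      using that partner_pair[OF A, of m "- n"] partner_pair[OF A, of "- n" m] by auto
    then show ?thesis using True rev server by auto
  next
    case customer
    then have "m = partner (loynes E x) (- n)" if "(m, - n) \<in> loynes E x \<or> (- n, m) \<in> loynes E x" for m
      using that partner_pair[OF A, of m "- n"] partner_pair[OF A, of "- n" m] by auto
    then show ?thesis using True rev customer by auto
  next
    case unmatched
    then show ?thesis using True rev by auto
  qed
next
  case False
  then have "\<not> two_sided_fcfs E x A" for A
    using loynes_limit_eq unfolding two_sided_fcfs_def by metis
  then have "the_matching E x = (THE A. False)" by (simp add: the_matching_def)
  then show ?thesis using False by (simp add: reversed_def exchange_partner)
qed

lemma measurable_reversed_at [measurable]:
  "(\<lambda>x. reversed E x n) \<in> measurable (path_space p) (count_space UNIV)"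
  for p :: "('c::countable + 's::countable) pmf"
proof -
  have "{x \<in> space (path_space p). reversed E x n = a} \<in> sets (path_space p)" for a
    unfolding reversed_eq_iff by measurable
  then show ?thesis
    by (subst measurable_count_space_eq2_countable) (auto simp: vimage_def)
qed

lemma measurable_into_path_space:
  assumes "\<And>n. (\<lambda>\<omega>. X \<omega> n) \<in> measurable M (count_space UNIV)"
  shows "X \<in> measurable M (path_space p)"
  unfolding path_space_def
proof (rule measurable_PiM_single')
  show "(\<lambda>\<omega>. X \<omega> i) \<in> measurable M (measure_pmf p)" for i
    using assms[of i] by (simp cong: measurable_cong_sets)
qed auto

lemma measurable_reversed [measurable]:
  "reversed E \<in> measurable (path_space p) (path_space p)"
  for p :: "('c::countable + 's::countable) pmf"
  by (rule measurable_into_path_space) simp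

lemma distr_reflection: "distr (path_space p) (path_space p) (\<lambda>x n. x (- n)) = path_space p"
proof -
  have "distr (PiM UNIV (\<lambda>_. measure_pmf p)) (PiM UNIV (\<lambda>_. measure_pmf p)) (\<lambda>x. \<lambda>n\<in>UNIV. x (- n)) =
      PiM UNIV (\<lambda>_ :: int. measure_pmf p)"
    by (rule distr_PiM_reindex[where f = uminus and K = UNIV]) (auto simp: measure_pmf.prob_space_axioms)
  then show ?thesis by (simp add: path_space_def restrict_def)
qed

text \<open>Summing the point masses extends the inequality to all sets; applied to the complement
  of a point it gives the reverse inequality, as both measures have total mass one.\<close>

lemma distr_eq_of_le:
  fixes f g :: "'w \<Rightarrow> 'a::countable"
  assumes M: "prob_space M"
    and f: "f \<in> measurable M (count_space UNIV)" and g: "g \<in> measurable M (count_space UNIV)"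
    and le: "\<And>a. measure M {\<omega> \<in> space M. f \<omega> = a} \<le> measure M {\<omega> \<in> space M. g \<omega> = a}"
  shows "distr M (count_space UNIV) f = distr M (count_space UNIV) g"
proof (rule measure_eqI_countable[where A = UNIV])
  interpret prob_space M by fact
  interpret F: prob_space "distr M (count_space UNIV) f" by (rule prob_space_distr[OF f])
  interpret G: prob_space "distr M (count_space UNIV) g" by (rule prob_space_distr[OF g])
  let ?F = "distr M (count_space UNIV) f" and ?G = "distr M (count_space UNIV) g"
  have le1: "emeasure ?F {a} \<le> emeasure ?G {a}" for a
    using le[of a] f g by (simp add: emeasure_distr emeasure_eq_measure vimage_def Collect_conj_eq Int_commute)
  have "emeasure ?F A \<le> emeasure ?G A" for A
  proof -
    have "emeasure ?F A = (\<integral>\<^sup>+ a. emeasure ?F {a} \<partial>count_space A)"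
      by (rule emeasure_countable_singleton) auto
    also have "\<dots> \<le> (\<integral>\<^sup>+ a. emeasure ?G {a} \<partial>count_space A)"
      using le1 by (intro nn_integral_mono)
    also have "\<dots> = emeasure ?G A"
      by (rule emeasure_countable_singleton[symmetric]) auto
    finally show ?thesis .
  qed
  then have le': "F.prob A \<le> G.prob A" for A
    by (simp add: F.emeasure_eq_measure G.emeasure_eq_measure)
  show "emeasure ?F {a} = emeasure ?G {a}" for a
    using le'[of "{a}"] le'[of "UNIV - {a}"] F.prob_compl[of "{a}"] G.prob_compl[of "{a}"]
    by (simp add: F.emeasure_eq_measure G.emeasure_eq_measure)
qed auto

context matching_rates
begin

text \<open>
  The sequence between the last regeneration point up to \<open>a\<close> and the first one from \<open>a + n\<close> on,
  with the distances of these two points from the window.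
\<close>

definition enclosing_block :: "int \<Rightarrow> nat \<Rightarrow> (int \<Rightarrow> 'c + 's) \<Rightarrow> nat \<times> nat \<times> ('c + 's) list" where
  "enclosing_block a n x =
     (let k = (LEAST k. empties_at E x (a - int k)); l = (LEAST l. empties_at E x (a + int n + int l))
      in (k, l, word x (a - int k) (k + n + l)))"

lemma enclosing_block_eq_iff:
  "enclosing_block a n x = (k, l, v) \<longleftrightarrow>
     (LEAST k. empties_at E x (a - int k)) = k \<and> (LEAST l. empties_at E x (a + int n + int l)) = l \<and>
     word x (a - int k) (k + n + l) = v"
  by (auto simp: enclosing_block_def Let_def)

lemma word_enclosing_block: "word x a n = (case enclosing_block a n x of (k, l, v) \<Rightarrow> take n (drop k v))"
  by (simp add: enclosing_block_def Let_def drop_word take_word add.assoc)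

lemma measurable_enclosing_block [measurable]: "enclosing_block a n \<in> measurable P (count_space UNIV)"
proof -
  have "{x \<in> space P. enclosing_block a n x = (k, l, v)} \<in> sets P" for k l v
    unfolding enclosing_block_eq_iff by measurable
  then show ?thesis
    by (subst measurable_count_space_eq2_countable) (auto simp: vimage_def)
qed

lemma enclosing_block_empties_at:
  assumes x: "regenerative E x A" and key: "enclosing_block a n x = (k, l, v)"
  shows "empties_at E x (a - int k)" "empties_at E x (a + int n + int l)"
proof -
  have "\<exists>k. empties_at E x (a - int k)"
  proof -
    obtain i where "i \<le> a" "cut_at UNIV x A i" using x unfolding regenerative_def by blast
    then show ?thesis using regenerative_empties_at_iff[OF x] by (intro exI[of _ "nat (a - i)"]) simp
  qed
  moreover have "\<exists>l. empties_at E x (a + int n + int l)"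
  proof -
    obtain i where "i \<ge> a + int n" "cut_at UNIV x A i" using x unfolding regenerative_def by blast
    then show ?thesis using regenerative_empties_at_iff[OF x] by (intro exI[of _ "nat (i - (a + int n))"]) simp
  qed
  ultimately show "empties_at E x (a - int k)" "empties_at E x (a + int n + int l)"
    using key LeastI_ex[of "\<lambda>k. empties_at E x (a - int k)"]
      LeastI_ex[of "\<lambda>l. empties_at E x (a + int n + int l)"] unfolding enclosing_block_eq_iff by auto
qed

text \<open>Once the left end is a regeneration point of \<open>y\<close>, the word alone decides
  which positions up to the right end regenerate. Both minimal distances therefore come out the
  same.\<close>

lemma enclosing_block_cong:
  assumes x: "regenerative E x A" and key: "enclosing_block a n x = (k, l, v)"
    and emp: "empties_at E y (a - int k)" and word: "word y (a - int k) (k + n + l) = v"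
  shows "enclosing_block a n y = (k, l, v)"
proof -
  have iff: "empties_at E y (a - int k + int m) \<longleftrightarrow> empties_at E x (a - int k + int m)" if "m \<le> k + n + l" for m
  proof -
    have "take m (word y (a - int k) (k + n + l)) = take m (word x (a - int k) (k + n + l))"
      using key word by (simp add: enclosing_block_eq_iff)
    then have "word y (a - int k) m = word x (a - int k) m" using that by (simp add: take_word)
    then show ?thesis using empties_at_iff_run[OF emp] empties_at_iff_run[OF enclosing_block_empties_at(1)[OF x key]] by simp
  qed
  have "empties_at E y (a + int n + int l)"
    using iff[of "k + n + l"] enclosing_block_empties_at(2)[OF x key] by (simp add: algebra_simps)
  moreover have "l \<le> l'" if "empties_at E y (a + int n + int l')" for l'
  proof (rule ccontr)
    assume "\<not> l \<le> l'"
    then have "empties_at E x (a + int n + int l')"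
      using iff[of "k + n + l'"] that by (simp add: algebra_simps)
    then have "(LEAST l. empties_at E x (a + int n + int l)) \<le> l'" by (rule Least_le)
    with key \<open>\<not> l \<le> l'\<close> show False by (simp add: enclosing_block_eq_iff)
  qed
  ultimately have "(LEAST l. empties_at E y (a + int n + int l)) = l"
    by (intro Least_equality)
  moreover have "k \<le> k'" if "empties_at E y (a - int k')" for k'
  proof (rule ccontr)
    assume "\<not> k \<le> k'"
    then have "empties_at E x (a - int k')"
      using iff[of "k - k'"] that by (simp add: of_nat_diff algebra_simps)
    then have "(LEAST k. empties_at E x (a - int k)) \<le> k'" by (rule Least_le)
    with key \<open>\<not> k \<le> k'\<close> show False by (simp add: enclosing_block_eq_iff)
  qed
  then have "(LEAST k. empties_at E y (a - int k)) = k"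
    using emp by (intro Least_equality)
  ultimately show ?thesis using word by (simp add: enclosing_block_eq_iff)
qed

text \<open>
  An inequality is enough, since both sides are point masses of probability distributions. Preimages
  of a block under the exchange all carry the same block, by the involution property.
\<close>

lemma prob_enclosing_block_reversed_le:
  "measure P {x \<in> space P. enclosing_block a n (reversed E x) = \<kappa>} \<le> measure P {x \<in> space P. enclosing_block a n x = \<kappa>}"
proof -
  interpret prob_space P by (rule prob_space_path_space)
  obtain k l v where \<kappa>: "\<kappa> = (k, l, v)" by (cases \<kappa>)
  define N where "N = k + n + l"
  define i where "i = a - int k"
  have j: "i + int N = a + int n + int l" by (simp add: i_def N_def)
  have sets: "{x. empties_at E x t \<and> word x t m \<in> V} \<in> sets P" for t m V
  proof -
    have "{x \<in> space P. empties_at E x t \<and> word x t m \<in> V} \<in> sets P" by measurable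
    then show ?thesis by simp
  qed
  show ?thesis
  proof (cases "\<exists>x A. regenerative E x A \<and> enclosing_block a n (reversed E x) = \<kappa>")
    case False
    \<comment> \<open>Almost every path is regenerative, so a block that no regenerative path
      produces has probability zero.\<close>
    have "AE x in P. x \<notin> {x \<in> space P. enclosing_block a n (reversed E x) = \<kappa>}"
      using AE_regenerative by eventually_elim (use False in auto)
    then have "prob {x \<in> space P. enclosing_block a n (reversed E x) = \<kappa>} = 0"
      by (subst prob_eq_0) measurable
    then show ?thesis by simp
  next
    case True
    then obtain x0 A0 where x0: "regenerative E x0 A0" and key0: "enclosing_block a n (reversed E x0) = (k, l, v)"
      using \<kappa> by blast
    define y0 where "y0 = reversed E x0"
    have y0: "regenerative E y0 (reverse_matching A0)" and rev_y0: "reversed E y0 = x0"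
      using regenerative_reversed[OF x0] by (simp_all add: y0_def)
    have word0: "word y0 i N = v" and emp0: "empties_at E y0 i" "empties_at E y0 (i + int N)"
      using key0 enclosing_block_empties_at[OF y0, of a n k l v] unfolding j
      by (simp_all add: y0_def[symmetric] enclosing_block_eq_iff i_def N_def)
    \<comment> \<open>The right end of the block becomes the left end of its preimage under the
      reflection of cuts.\<close>
    define i' where "i' = 1 - (i + int N)"
    define v' where "v' = word x0 i' N"
    have len: "length v = N" "length v' = N" using word0 by (auto simp: v'_def)
    have "mset v' = mset v"
      using mset_reversed_word[OF y0 emp0] unfolding rev_y0 word0 by (simp add: v'_def i'_def)
    then have pmf: "pmf (replicate_pmf N item) v' = pmf (replicate_pmf N item) v"
      using pmf_replicate_pmf[of v item] pmf_replicate_pmf[of v' item] len by simp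
    \<comment> \<open>One sample preimage \<open>x0\<close> fixes the word \<open>v'\<close>. Any
      other preimage has the same exchanged block, and exchanging it back yields the same word at
      the same place.\<close>
    have "empties_at E x i' \<and> word x i' N \<in> {v'}"
      if x: "regenerative E x A" and key: "enclosing_block a n (reversed E x) = (k, l, v)" for x A
    proof -
      have y: "regenerative E (reversed E x) (reverse_matching A)" and rev: "reversed E (reversed E x) = x"
        using regenerative_reversed[OF x] by simp_all
      have w: "word (reversed E x) i N = v"
        and emp: "empties_at E (reversed E x) i" "empties_at E (reversed E x) (i + int N)"
        using key enclosing_block_empties_at[OF y key] unfolding j by (simp_all add: enclosing_block_eq_iff i_def N_def)
      have "empties_at E x i'"
        using regenerative_reversed(3)[OF y emp(2)] unfolding rev i'_def .
      moreover have "word x i' N = v'"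
        using reversed_word_cong[OF y y0 _ emp(1) emp0(1) emp(2) emp0(2)] w word0
        unfolding rev rev_y0 v'_def i'_def by simp
      ultimately show ?thesis by simp
    qed
    then have "AE x in P. x \<in> {x \<in> space P. enclosing_block a n (reversed E x) = \<kappa>} \<longrightarrow>
        x \<in> {x. empties_at E x i' \<and> word x i' N \<in> {v'}}"
      using AE_regenerative unfolding \<kappa> by (auto elim!: eventually_mono)
    then have "prob {x \<in> space P. enclosing_block a n (reversed E x) = \<kappa>} \<le>
        prob {x. empties_at E x i' \<and> word x i' N \<in> {v'}}"
      using sets by (rule finite_measure_mono_AE)
    \<comment> \<open>The probability of emptiness does not depend on the position, and
      \<open>v'\<close> is a rearrangement of \<open>v\<close>.\<close>
    also have "\<dots> = prob {x. empties_at E x i \<and> word x i N \<in> {v}}"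
      unfolding prob_empties_at_word by (simp add: measure_pmf_single pmf)
    also have "\<dots> \<le> prob {x \<in> space P. enclosing_block a n x = \<kappa>}"
    proof (rule finite_measure_mono)
      show "{x. empties_at E x i \<and> word x i N \<in> {v}} \<subseteq> {x \<in> space P. enclosing_block a n x = \<kappa>}"
        using enclosing_block_cong[OF y0, of a n k l v] key0 unfolding \<kappa> i_def N_def y0_def by auto
    qed measurable
    finally show ?thesis .
  qed
qed

text \<open>Partners of positions in a window may lie outside it, so laws are compared for the
  enclosing blocks; the window is a function of its block.\<close>

lemma distr_word_reversed:
  "distr P (count_space UNIV) (\<lambda>x. word (reversed E x) a n) = measure_pmf (replicate_pmf n item)"
proof -
  let ?h = "\<lambda>(k, l, v). take n (drop k v)"
  have "distr P (count_space UNIV) (\<lambda>x. enclosing_block a n (reversed E x)) = distr P (count_space UNIV) (enclosing_block a n)"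
    by (rule distr_eq_of_le[OF prob_space_path_space _ _ prob_enclosing_block_reversed_le]) measurable
  then have "distr (distr P (count_space UNIV) (\<lambda>x. enclosing_block a n (reversed E x))) (count_space UNIV) ?h =
      distr (distr P (count_space UNIV) (enclosing_block a n)) (count_space UNIV) ?h"
    by simp
  then have "distr P (count_space UNIV) (\<lambda>x. word (reversed E x) a n) = distr P (count_space UNIV) (\<lambda>x. word x a n)"
    by (simp add: distr_distr comp_def word_enclosing_block)
  then show ?thesis by (simp add: distr_word)
qed

lemma distr_reversed: "distr P P (reversed E) = P"
proof -
  interpret prob_space P by (rule prob_space_path_space)
  have "distr P P (reversed E) = PiM UNIV (\<lambda>_. measure_pmf item)"
  proof (rule measure_eqI_PiM_infinite)
    fix J :: "int set" and A :: "int \<Rightarrow> ('c + 's) set"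
    assume J: "finite J"
    obtain a b where ab: "J \<subseteq> {a..<b}"
    proof
      show "J \<subseteq> {Min J..<Max J + 1}"
      proof
        fix j assume "j \<in> J"
        then show "j \<in> {Min J..<Max J + 1}"
          using Min_le[OF J, of j] Max_ge[OF J, of j] by simp
      qed
    qed
    define n where "n = nat (b - a)"
    define V where "V = {v. \<forall>j\<in>J. v ! nat (j - a) \<in> A j}"
    have emb: "prod_emb UNIV (\<lambda>_. measure_pmf item) J (Pi\<^sub>E J A) = {x. word x a n \<in> V}"
    proof -
      have "word x a n ! nat (j - a) = x j" if "j \<in> J" for x :: "int \<Rightarrow> 'c + 's" and j
        using ab that by (auto simp: word_def n_def)
      then show ?thesis by (auto simp: prod_emb_def V_def PiE_iff)
    qed
    have sets: "{x. word x a n \<in> V} \<in> sets P"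
    proof -
      have "{x \<in> space P. word x a n \<in> V} \<in> sets P" by measurable
      then show ?thesis by simp
    qed
    have "emeasure (distr P P (reversed E)) {x. word x a n \<in> V} =
        emeasure (distr P (count_space UNIV) (\<lambda>x. word (reversed E x) a n)) V"
      using sets by (simp add: emeasure_distr vimage_def)
    also have "\<dots> = emeasure (distr P (count_space UNIV) (\<lambda>x. word x a n)) V"
      by (simp add: distr_word distr_word_reversed)
    also have "\<dots> = emeasure P {x. word x a n \<in> V}"
      by (simp add: emeasure_distr vimage_def)
    finally show "emeasure (distr P P (reversed E)) (prod_emb UNIV (\<lambda>_. measure_pmf item) J (Pi\<^sub>E J A)) =
        emeasure (PiM UNIV (\<lambda>_. measure_pmf item)) (prod_emb UNIV (\<lambda>_. measure_pmf item) J (Pi\<^sub>E J A))"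
      unfolding emb by (simp add: path_space_def)
  qed (auto simp: path_space_def[symmetric] intro!: prob_space.finite_measure prob_space_distr)
  then show ?thesis by (simp add: path_space_def)
qed

end

text \<open>The bridge between \<open>M\<close> and the canonical space: one direction carries the
  given sequence over, the other brings the exchanged sequence back.\<close>

lemma iid_iff_distr_path_space:
  fixes X :: "int \<Rightarrow> 'w \<Rightarrow> 'a"
  assumes M: "prob_space M" and X: "\<And>n. X n \<in> measurable M (count_space UNIV)"
  shows "prob_space.indep_vars M (\<lambda>_. count_space UNIV) X UNIV \<and>
      (\<forall>n. distr M (count_space UNIV) (X n) = measure_pmf p) \<longleftrightarrow>
    distr M (path_space p) (\<lambda>\<omega> n. X n \<omega>) = path_space p" (is "?L \<longleftrightarrow> ?R")
proof -
  interpret prob_space M by fact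
  have sets: "sets (PiM UNIV (\<lambda>_. count_space UNIV)) = sets (path_space p)"
    unfolding path_space_def by (intro sets_PiM_cong) auto
  have eq: "distr M (PiM UNIV (\<lambda>_. count_space UNIV)) (\<lambda>\<omega>. \<lambda>n\<in>UNIV. X n \<omega>) =
      distr M (path_space p) (\<lambda>\<omega> n. X n \<omega>)"
    by (intro distr_cong sets) auto
  have ind: "indep_vars (\<lambda>_. count_space UNIV) X UNIV \<longleftrightarrow>
      distr M (path_space p) (\<lambda>\<omega> n. X n \<omega>) = PiM UNIV (\<lambda>n. distr M (count_space UNIV) (X n))"
    using X by (subst indep_vars_iff_distr_eq_PiM) (simp_all add: eq)
  show ?thesis
  proof
    assume ?L
    then have "PiM UNIV (\<lambda>n. distr M (count_space UNIV) (X n)) = path_space p"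
      by (simp add: path_space_def)
    then show ?R using \<open>?L\<close> ind by simp
  next
    assume R: ?R
    have marg: "distr M (count_space UNIV) (X n) = measure_pmf p" for n
    proof -
      have "distr M (count_space UNIV) (X n) = distr (distr M (path_space p) (\<lambda>\<omega> n. X n \<omega>)) (count_space UNIV) (\<lambda>x. x n)"
        using X by (subst distr_distr) (auto simp: comp_def intro!: measurable_into_path_space)
      also have "\<dots> = distr (PiM UNIV (\<lambda>_. measure_pmf p)) (measure_pmf p) (\<lambda>x. x n)"
        unfolding R unfolding path_space_def by (intro distr_cong) auto
      also have "\<dots> = measure_pmf p"
        by (rule distr_PiM_component) (auto simp: measure_pmf.prob_space_axioms)
      finally show ?thesis .
    qed
    moreover have "indep_vars (\<lambda>_. count_space UNIV) X UNIV"
      unfolding ind marg path_space_def[symmetric] by (rule R)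
    ultimately show ?L by blast
  qed
qed

theorem theorem6p3:
  fixes E :: "('s::finite \<times> 'c::finite) set"
    and lam :: "'c \<Rightarrow> real" and mu :: "'s \<Rightarrow> real"
    and M :: "'w measure"
    and z :: "int \<Rightarrow> 'w \<Rightarrow> 'c + 's"
  assumes "prob_space M"
    and "\<And>c. lam c > 0" and "\<And>s. mu s > 0"
    and stability: "\<And>C. C \<noteq> {} \<Longrightarrow> sum lam C < sum mu (servers_of E C)"
    and iid: "iid_sequence M z"
    and customer_prob: "\<And>n c. measure M {\<omega> \<in> space M. z n \<omega> = Inl c} =
                  lam c / (sum lam UNIV + sum mu UNIV)"
    and server_prob: "\<And>n s. measure M {\<omega> \<in> space M. z n \<omega> = Inr s} =
                  mu s / (sum lam UNIV + sum mu UNIV)"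
  defines "x \<equiv> \<lambda>\<omega> n. z n \<omega>"
  defines "xt \<equiv> \<lambda>\<omega>. exchange (the_matching E (x \<omega>)) (x \<omega>)"
  defines "w \<equiv> \<lambda>\<omega> n. xt \<omega> (- n)"
  shows "iid_sequence M (\<lambda>n \<omega>. xt \<omega> n) \<and>
    (AE \<omega> in M.
       (\<exists>!A. two_sided_fcfs E (x \<omega>) A) \<and>
       (\<exists>!B. two_sided_fcfs E (w \<omega>) B) \<and>
       (\<forall>m n. m < n \<longrightarrow>
          ((m, n) \<in> the_matching E (x \<omega>) \<longleftrightarrow> (- n, - m) \<in> the_matching E (w \<omega>))))"
proof -
  interpret prob_space M by fact
  interpret matching_rates E lam mu
    by unfold_locales (use assms in auto)
  have z: "z n \<in> measurable M (count_space UNIV)" for n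
    using iid unfolding iid_sequence_def indep_vars_def by auto
  have marginal: "distr M (count_space UNIV) (z n) = measure_pmf item" for n
  proof (rule measure_eqI_countable[where A = UNIV])
    fix a
    have "emeasure (distr M (count_space UNIV) (z n)) {a} = ennreal (measure M {\<omega> \<in> space M. z n \<omega> = a})"
      using z[of n] by (simp add: emeasure_distr emeasure_eq_measure vimage_def Collect_conj_eq Int_commute)
    also have "measure M {\<omega> \<in> space M. z n \<omega> = a} = pmf item a"
      using customer_prob server_prob by (simp add: pmf_item total_rate_def split: sum.split)
    finally show "emeasure (distr M (count_space UNIV) (z n)) {a} = emeasure (measure_pmf item) {a}"
      by (simp add: emeasure_pmf_single)
  qed auto
  have x_meas: "x \<in> measurable M P"
    unfolding x_def using z by (intro measurable_into_path_space) simp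
  have x_distr: "distr M P x = P"
    using iid_iff_distr_path_space[OF \<open>prob_space M\<close> z, where p = item] iid marginal
    by (simp add: iid_sequence_def x_def)
  have w_eq: "w \<omega> = reversed E (x \<omega>)" for \<omega>
    by (simp add: w_def xt_def reversed_def fun_eq_iff)
  have w_meas: "w \<in> measurable M P"
    unfolding w_eq[abs_def] using x_meas by (rule measurable_compose) simp
  have "distr M P w = distr (distr M P x) P (reversed E)"
    using x_meas by (simp add: distr_distr comp_def w_eq[abs_def])
  then have w_distr: "distr M P w = P"
    by (simp add: x_distr distr_reversed)
  have xt_eq: "xt = (\<lambda>\<omega> n. w \<omega> (- n))"
    by (simp add: w_def fun_eq_iff)
  have xt_meas: "(\<lambda>\<omega>. xt \<omega> n) \<in> measurable M (count_space UNIV)" for n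
    unfolding xt_eq by (rule measurable_compose[OF w_meas]) simp
  \<comment> \<open>The exchanged sequence in its original time direction is the reflection of
    \<open>w\<close>, and the i.i.d. law is invariant under reflection.\<close>
  have "distr M P xt = distr (distr M P w) P (\<lambda>y n. y (- n))"
    using w_meas by (subst distr_distr) (auto simp: comp_def xt_eq intro!: measurable_into_path_space)
  then have "distr M P (\<lambda>\<omega> n. xt \<omega> n) = P"
    by (simp add: w_distr distr_reflection)
  then have "iid_sequence M (\<lambda>n \<omega>. xt \<omega> n)"
    using iid_iff_distr_path_space[where X = "\<lambda>n \<omega>. xt \<omega> n" and p = item, OF \<open>prob_space M\<close> xt_meas]
    by (simp add: iid_sequence_def)
  moreover have "AE \<omega> in M. \<exists>A. regenerative E (x \<omega>) A"
    by (rule AE_distrD[OF x_meas]) (simp only: x_distr AE_regenerative)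
  then have "AE \<omega> in M.
       (\<exists>!A. two_sided_fcfs E (x \<omega>) A) \<and> (\<exists>!B. two_sided_fcfs E (w \<omega>) B) \<and>
       (\<forall>m n. m < n \<longrightarrow> ((m, n) \<in> the_matching E (x \<omega>) \<longleftrightarrow> (- n, - m) \<in> the_matching E (w \<omega>)))"
  proof eventually_elim
    case (elim \<omega>)
    then obtain A where A: "regenerative E (x \<omega>) A" by blast
    have B: "regenerative E (w \<omega>) (reverse_matching A)" unfolding w_eq by (rule regenerative_reversed(1)[OF A])
    show ?case
      using regenerative_ex1_two_sided[OF A] regenerative_ex1_two_sided[OF B]
      by (simp add: regenerative_the_matching[OF A] regenerative_the_matching[OF B])
  qed
  ultimately show ?thesis ..
qed

end
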